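(* For all $m\geq 1$ and $n\geq 1$, $$\sum_{P\in\mathrm{Polyo}_{m,n}} q^{\mathsf{area}(P)}t^{\mathsf{bounce}(P)}=\sum_{P\in\mathrm{Polyo}_{n,m}} q^{\mathsf{dinv}(P)}t^{\mathsf{area}(P)}.$$ Equivalently, there is a bijection $\mathrm{Polyo}_{m,n}\to\mathrm{Polyo}_{n,m}$ sending the pair of statistics $(\mathsf{area},\mathsf{bounce})$ to $(\mathsf{dinv},\mathsf{area})$.
   Context: A parallelogram polyomino with an $m\times n$ bounding box is a pair of lattice paths (upper and lower) from $(0,0)$ to $(m,n)$ with unit North and East steps meeting only at their endpoints, the upper path starting with North, the lower with East. $\mathrm{Polyo}_{m,n}$ is the set of these. $\mathsf{area}(P)$ is the number of unit squares between the two paths. Area word: for each East step of the lower path, draw from its East endpoint a line of slope $-1$ going Northwest until it reaches the upper path; label the step with the number of squares crossed. Label each North step of the upper path with $\overline{k}$, $k$ = number of interior squares in the row immediately East of it not crossed by any such line. Read labels in increasing order of $x+y$ of the starting point of the step, upper-path label first in ties. $\mathsf{dinv}(P)$: using the total order $\overline{0}<1<\overline{1}<2<\overline{2}<3<\cdots$, it is the number of pairs $i<j$ such that $a_j$ is the immediate successor of $a_i$, where $a_1\cdots a_{m+n}$ is the area word of $P$. $\mathsf{bounce}(P)$: the bounce path starts at $(0,0)$ with a single East step, then goes North until reaching the East endpoint of a horizontal step of the upper path, then goes East until reaching the North endpoint of a vertical step of the lower path, then North again, and so on, until reaching $(m,n)$. The steps of the successive maximal runs of vertical steps are labelled $1,2,3,\dots$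 (all steps of the $i$-th vertical run get label $i$), and the steps of the successive maximal runs of horizontal steps are labelled $\overline{0},\overline{1},\overline{2},\dots$ (the first run being the initial East step(s)). $\mathsf{bounce}(P)$ is the sum of all these labels, ignoring bars. *)

theory Defs
  imports Main
begin

datatype step = North | East

fun move :: "step \<Rightarrow> nat \<times> nat \<Rightarrow> nat \<times> nat" where
  "move North (x, y) = (x, Suc y)"
| "move East (x, y) = (Suc x, y)"

text \<open>All paths start at \<open>(0, 0)\<close>, so the \<open>k\<close>-th vertex \<open>(x, y)\<close> satisfies \<open>x + y = k\<close>.\<close>

definition vertex :: "step list \<Rightarrow> nat \<Rightarrow> nat \<times> nat" where
  "vertex p k = (count_list (take k p) East, count_list (take k p) North)"

definition vertices :: "step list \<Rightarrow> (nat \<times> nat) set" where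
  "vertices p = vertex p ` {..length p}"

definition lattice_paths :: "nat \<Rightarrow> nat \<Rightarrow> step list set" where
  "lattice_paths m n = {p. count_list p East = m \<and> count_list p North = n}"

definition start_points :: "step \<Rightarrow> step list \<Rightarrow> (nat \<times> nat) set" where
  "start_points d p = {vertex p k | k. k < length p \<and> p ! k = d}"

definition end_points :: "step \<Rightarrow> step list \<Rightarrow> (nat \<times> nat) set" where
  "end_points d p = {vertex p (Suc k) | k. k < length p \<and> p ! k = d}"

text \<open>A polyomino is the pair (upper path, lower path).  Two monotone lattice paths that share
  any point other than a lattice point share a whole unit step, so it suffices to look at common
  lattice points.\<close>

type_synonym polyomino = "step list \<times> step list"

definition Polyo :: "nat \<Rightarrow> nat \<Rightarrow> polyomino set" where
  "Polyo m n = {(U, L). U \<in> lattice_paths m n \<and> L \<in> lattice_paths m n \<and>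
     U \<noteq> [] \<and> hd U = North \<and> L \<noteq> [] \<and> hd L = East \<and>
     vertices U \<inter> vertices L = {(0, 0), (m, n)}}"

text \<open>A unit square is represented by its lower left corner.  The squares between the two paths
  are, row by row, those between the North step of the upper path and that of the lower path.\<close>

fun squares :: "polyomino \<Rightarrow> (nat \<times> nat) set" where
  "squares (U, L) = {(x, y). \<exists>a b. (a, y) \<in> start_points North U \<and>
     (b, y) \<in> start_points North L \<and> a \<le> x \<and> x < b}"

definition area :: "polyomino \<Rightarrow> nat" where
  "area P = card (squares P)"

text \<open>The line of slope \<open>-1\<close> from \<open>(x, y)\<close> meets a lattice path in a lattice point
  \<open>(x - i, y + i)\<close>; on its way there it crosses \<open>i\<close> unit squares.\<close>

definition line_length :: "step list \<Rightarrow> nat \<times> nat \<Rightarrow> nat" where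
  "line_length U = (\<lambda>(x, y). LEAST i. i \<le> x \<and> (x - i, y + i) \<in> vertices U)"

definition crossed :: "step list \<Rightarrow> nat \<times> nat \<Rightarrow> (nat \<times> nat) set" where
  "crossed U = (\<lambda>(x, y). {(x - Suc i, y + i) | i. i < line_length U (x, y)})"

datatype letter = Bar nat | Plain nat

text \<open>The order \<open>Bar 0 < Plain 1 < Bar 1 < Plain 2 < Bar 2 < \<dots>\<close>.  The letter \<open>Plain 0\<close>, which is
  not a label, becomes the least element.\<close>

fun letter_less :: "letter \<Rightarrow> letter \<Rightarrow> bool" where
  "letter_less (Bar k) (Bar l) \<longleftrightarrow> k < l"
| "letter_less (Plain k) (Plain l) \<longleftrightarrow> k < l"
| "letter_less (Bar k) (Plain l) \<longleftrightarrow> k < l"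
| "letter_less (Plain k) (Bar l) \<longleftrightarrow> k \<le> l"

definition immediate_succ :: "letter \<Rightarrow> letter \<Rightarrow> bool" where
  "immediate_succ a b \<longleftrightarrow> letter_less a b \<and> (\<nexists>c. letter_less a c \<and> letter_less c b)"

fun lower_label :: "polyomino \<Rightarrow> nat \<Rightarrow> letter" where
  "lower_label (U, L) k = Plain (card (crossed U (vertex L (Suc k))))"

fun upper_label :: "polyomino \<Rightarrow> nat \<Rightarrow> letter" where
  "upper_label (U, L) k =
     Bar (card {s \<in> squares (U, L). snd s = snd (vertex U k) \<and>
                  s \<notin> (\<Union>e \<in> end_points East L. crossed U e)})"

fun area_word :: "polyomino \<Rightarrow> letter list" where
  "area_word (U, L) = concat (map (\<lambda>k.
      (if U ! k = North then [upper_label (U, L) k] else []) @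
      (if L ! k = East then [lower_label (U, L) k] else [])) [0..<length U])"

definition dinv :: "polyomino \<Rightarrow> nat" where
  "dinv P = card {(i, j). i < j \<and> j < length (area_word P) \<and>
     immediate_succ (area_word P ! i) (area_word P ! j)}"

text \<open>\<open>bounce_walk U L r d v\<close> consists of the next \<open>r\<close> steps of the bounce path when it has
  arrived at \<open>v\<close> in direction \<open>d\<close>.\<close>

fun turn :: "step list \<Rightarrow> step list \<Rightarrow> step \<Rightarrow> nat \<times> nat \<Rightarrow> step" where
  "turn U L North v = (if v \<in> end_points East U then East else North)"
| "turn U L East v = (if v \<in> end_points North L then North else East)"

primrec bounce_walk ::
  "step list \<Rightarrow> step list \<Rightarrow> nat \<Rightarrow> step \<Rightarrow> nat \<times> nat \<Rightarrow> step list" where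
  "bounce_walk U L 0 d v = []"
| "bounce_walk U L (Suc r) d v =
     turn U L d v # bounce_walk U L r (turn U L d v) (move (turn U L d v) v)"

text \<open>After the initial East step the direction is set to North, since exactly one East step is
  taken first.  A path from \<open>(0, 0)\<close> to \<open>(m, n)\<close> has \<open>m + n\<close> steps, as many as the upper path.\<close>

fun bounce_path :: "polyomino \<Rightarrow> step list" where
  "bounce_path (U, L) = East # bounce_walk U L (length U - 1) North (1, 0)"

text \<open>The position, counted from \<open>1\<close>, of the maximal run containing the \<open>k\<close>-th step among the
  maximal runs in the same direction.\<close>

definition run_number :: "step list \<Rightarrow> nat \<Rightarrow> nat" where
  "run_number p k = card {j. j \<le> k \<and> p ! j = p ! k \<and> (j = 0 \<or> p ! (j - 1) \<noteq> p ! j)}"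

definition bounce_label :: "step list \<Rightarrow> nat \<Rightarrow> nat" where
  "bounce_label p k = (case p ! k of North \<Rightarrow> run_number p k | East \<Rightarrow> run_number p k - 1)"

definition bounce :: "polyomino \<Rightarrow> nat" where
  "bounce P = (\<Sum>k<length (bounce_path P). bounce_label (bounce_path P) k)"

lemma length_lattice_path: "p \<in> lattice_paths m n \<Longrightarrow> length p = m + n"
proof -
  have "length p = count_list p East + count_list p North"
  proof (induction p)
    case (Cons d p)
    then show ?case by (cases d) auto
  qed simp
  then show "p \<in> lattice_paths m n \<Longrightarrow> length p = m + n"
    by (simp add: lattice_paths_def)
qed

lemma finite_Polyo: "finite (Polyo m n)"
proof -
  have "(UNIV :: step set) = {North, East}"
    using step.exhaust by blast
  then have "finite (UNIV :: step set)"
    by (metis finite.emptyI finite.insertI)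
  then have "finite {p :: step list. set p \<subseteq> UNIV \<and> length p = m + n}"
    by (rule finite_lists_length_eq)
  then have "finite (lattice_paths m n)"
    by (rule rev_finite_subset) (auto dest: length_lattice_path)
  then have "finite (lattice_paths m n \<times> lattice_paths m n)"
    by simp
  then show ?thesis
    by (rule rev_finite_subset) (auto simp: Polyo_def)
qed

end

theory Submission
  imports Defs
begin

text \<open>Both sides are statistics of one set of words. Encode the letters \<open>Bar k\<close> and \<open>Plain k\<close> as
  \<open>2k\<close> and \<open>2k - 1\<close>, so that immediate successors differ by one. The area word of a polyomino starts
  with its only \<open>0\<close>, and a letter exceeds its predecessor by at most one; \<open>dinv\<close> counts the pairs of
  positions carrying \<open>x\<close> and later \<open>x + 1\<close>, and the area is the sum of the labels.

  Conversely, from such a word \<open>w\<close> read off, for each \<open>i\<close>, the reversed subword of the letters \<open>i\<close>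
  and \<open>i + 1\<close>, with even letters as East and odd letters as North steps. Concatenating these for even
  \<open>i\<close> gives an upper path, and for odd \<open>i\<close>, after an initial East step, a lower path. The \<open>i\<close>-th run of
  the bounce path then has as many steps as \<open>w\<close> has letters \<open>i\<close>, so that bounce is the sum of the
  labels, while the area between the bounce path and the two paths counts the pairs of \<open>dinv\<close>.

  Both constructions are injective. Together they inject \<^term>\<open>Polyo n m\<close> into \<^term>\<open>Polyo m n\<close>
  for all \<open>m\<close> and \<open>n\<close>, so by finiteness the injection is a bijection.\<close>

section \<open>Heights and areas\<close>

abbreviation height :: "step list \<Rightarrow> nat \<Rightarrow> nat" where
  "height p k \<equiv> count_list (take k p) North"

lemma count_East_North: "count_list p East + count_list p North = length p"
proof (induction p)
  case (Cons d p)
  then show ?case by (cases d) auto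
qed simp

lemma height_Suc:
  "k < length p \<Longrightarrow> height p (Suc k) = height p k + (if p ! k = North then 1 else 0)"
  by (simp add: take_Suc_conv_app_nth)

lemma height_mono: "i \<le> j \<Longrightarrow> height p i \<le> height p j"
  by (metis count_list_append le_add1 le_iff_add take_add)

lemma height_le: "height p k \<le> k"
  by (metis count_le_length le_trans length_take min.cobounded2)

lemma height_le_count: "height p k \<le> count_list p North"
  by (metis append_take_drop_id count_list_append le_add1)

lemma vertex_height: "k \<le> length p \<Longrightarrow> vertex p k = (k - height p k, height p k)"
  unfolding vertex_def using count_East_North[of "take k p"] by simp

lemma vertex_eq_iff:
  assumes "j \<le> length p" "k \<le> length q"
  shows "vertex p j = vertex q k \<longleftrightarrow> j = k \<and> height p j = height q k"
  using assms height_le[of j p] height_le[of k q] by (auto simp: vertex_height)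

lemma mem_vertices:
  "(x, y) \<in> vertices p \<longleftrightarrow> x + y \<le> length p \<and> height p (x + y) = y"
proof
  assume "(x, y) \<in> vertices p"
  then obtain k where k: "k \<le> length p" "(x, y) = vertex p k"
    by (auto simp: vertices_def)
  then show "x + y \<le> length p \<and> height p (x + y) = y"
    using height_le[of k p] by (auto simp: vertex_height)
next
  assume "x + y \<le> length p \<and> height p (x + y) = y"
  then have "(x, y) = vertex p (x + y)" "x + y \<le> length p"
    by (auto simp: vertex_height)
  then show "(x, y) \<in> vertices p"
    unfolding vertices_def by blast
qed

lemma height_attained:
  assumes "y < height p j"
  shows "\<exists>k < length p. k < j \<and> p ! k = North \<and> height p k = y"
  using assms
proof (induction j)
  case (Suc j)
  show ?case
  proof (cases "y < height p j")
    case True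
    then show ?thesis using Suc.IH less_Suc_eq by blast
  next
    case False
    then have j: "j < length p"
      using Suc.prems by (metis not_less take_all le_SucI)
    with False Suc.prems have "p ! j = North" "height p j = y"
      by (auto simp: height_Suc split: if_splits)
    with j show ?thesis by blast
  qed
qed simp

lemma height_North_less:
  assumes "j < k" "j < length p" "p ! j = North"
  shows "height p j < height p k"
  using height_mono[of "Suc j" k p] assms by (simp add: height_Suc)

lemma mem_start_points:
  "(x, y) \<in> start_points North p \<longleftrightarrow> x + y < length p \<and> p ! (x + y) = North \<and> height p (x + y) = y"
proof -
  have "(x, y) = vertex p k \<longleftrightarrow> k = x + y \<and> height p (x + y) = y" if "k < length p" for k
    using that height_le[of k p] by (auto simp: vertex_height)
  then show ?thesis unfolding start_points_def by auto
qed

lemma start_point_left_iff: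
  "(\<exists>a. (a, y) \<in> start_points North p \<and> a \<le> x) \<longleftrightarrow> y < height p (Suc (x + y))"
proof
  assume "\<exists>a. (a, y) \<in> start_points North p \<and> a \<le> x"
  then obtain a where "a + y < length p" "p ! (a + y) = North" "height p (a + y) = y" "a \<le> x"
    by (auto simp: mem_start_points)
  then show "y < height p (Suc (x + y))"
    using height_North_less[of "a + y" "Suc (x + y)" p] by simp
next
  assume "y < height p (Suc (x + y))"
  then obtain k where k: "k < length p" "k < Suc (x + y)" "p ! k = North" "height p k = y"
    using height_attained by blast
  then have "(k - y, y) \<in> start_points North p" "k - y \<le> x"
    using height_le[of k p] by (auto simp: mem_start_points)
  then show "\<exists>a. (a, y) \<in> start_points North p \<and> a \<le> x" by blast
qed

lemma start_point_right_iff: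
  "(\<exists>b. (b, y) \<in> start_points North p \<and> x < b) \<longleftrightarrow>
     height p (Suc (x + y)) \<le> y \<and> y < count_list p North"
proof
  assume "\<exists>b. (b, y) \<in> start_points North p \<and> x < b"
  then obtain b where b: "b + y < length p" "p ! (b + y) = North" "height p (b + y) = y" "x < b"
    by (auto simp: mem_start_points)
  then show "height p (Suc (x + y)) \<le> y \<and> y < count_list p North"
    using height_mono[of "Suc (x + y)" "b + y" p] height_North_less[of "b + y" "length p" p]
    by simp
next
  assume *: "height p (Suc (x + y)) \<le> y \<and> y < count_list p North"
  then obtain k where k: "k < length p" "p ! k = North" "height p k = y"
    using height_attained[of y "length p" p] by auto
  have "\<not> k < Suc (x + y)"
  proof
    assume "k < Suc (x + y)"
    from height_North_less[OF this k(1,2)] show False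
      using k(3) * by simp
  qed
  with k have "(k - y, y) \<in> start_points North p" "x < k - y"
    using height_le[of k p] by (auto simp: mem_start_points)
  then show "\<exists>b. (b, y) \<in> start_points North p \<and> x < b" by blast
qed

lemma squares_height:
  assumes "count_list U North = count_list L North"
  shows "squares (U, L) =
    {(x, y). height L (Suc (x + y)) \<le> y \<and> y < height U (Suc (x + y))}"
proof -
  have "(x, y) \<in> squares (U, L) \<longleftrightarrow>
      height L (Suc (x + y)) \<le> y \<and> y < height U (Suc (x + y))" for x y
  proof -
    have "(x, y) \<in> squares (U, L) \<longleftrightarrow> (\<exists>a. (a, y) \<in> start_points North U \<and> a \<le> x) \<and>
        (\<exists>b. (b, y) \<in> start_points North L \<and> x < b)"
      by auto
    also have "\<dots> \<longleftrightarrow> height L (Suc (x + y)) \<le> y \<and> y < height U (Suc (x + y))"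
      unfolding start_point_left_iff start_point_right_iff
      using assms height_le_count[of "Suc (x + y)" U] by auto
    finally show ?thesis .
  qed
  then show ?thesis by auto
qed

lemma Polyo_iff:
  assumes "m \<ge> 1" "n \<ge> 1"
  shows "(U, L) \<in> Polyo m n \<longleftrightarrow> U \<in> lattice_paths m n \<and> L \<in> lattice_paths m n \<and>
    (\<forall>k. 0 < k \<and> k < m + n \<longrightarrow> height L k < height U k)"
proof
  assume P: "(U, L) \<in> Polyo m n"
  then have UL: "U \<in> lattice_paths m n" "L \<in> lattice_paths m n"
    by (auto simp: Polyo_def)
  note len = length_lattice_path[OF UL(1)] length_lattice_path[OF UL(2)]
  have ne: "height L k \<noteq> height U k" if "0 < k" "k < m + n" for k
  proof
    assume eq: "height L k = height U k"
    define v where "v = (k - height U k, height U k)"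
    have "v \<in> vertices U" "v \<in> vertices L"
      using that eq height_le[of k U] len by (auto simp: v_def mem_vertices)
    then have "v \<in> {(0, 0), (m, n)}"
      using P unfolding Polyo_def by blast
    then show False
      using that height_le[of k U] by (auto simp: v_def)
  qed
  have "height L k < height U k" if "0 < k" "k < m + n" for k
    using that
  proof (induction k rule: nat_induct_non_zero)
    case 1
    obtain U' L' where "U = North # U'" "L = East # L'"
      using P by (cases U; cases L) (auto simp: Polyo_def)
    then show ?case by simp
  next
    case (Suc k)
    then have "height L k < height U k" by simp
    then show ?case
      using ne[of "Suc k"] Suc.prems len by (auto simp: height_Suc)
  qed
  then show "U \<in> lattice_paths m n \<and> L \<in> lattice_paths m n \<and>
      (\<forall>k. 0 < k \<and> k < m + n \<longrightarrow> height L k < height U k)"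
    using UL by blast
next
  assume *: "U \<in> lattice_paths m n \<and> L \<in> lattice_paths m n \<and>
    (\<forall>k. 0 < k \<and> k < m + n \<longrightarrow> height L k < height U k)"
  then have UL: "U \<in> lattice_paths m n" "L \<in> lattice_paths m n" by auto
  note len = length_lattice_path[OF UL(1)] length_lattice_path[OF UL(2)]
  obtain d U' where U: "U = d # U'" using len assms by (cases U) auto
  obtain e L' where L: "L = e # L'" using len assms by (cases L) auto
  have "height L 1 < height U 1" using * assms by auto
  then have de: "d = North" "e = East"
    using U L by (cases d; cases e; simp)+
  have "vertices U \<inter> vertices L = {(0, 0), (m, n)}"
  proof (intro subset_antisym subsetI)
    fix v assume v: "v \<in> vertices U \<inter> vertices L"
    obtain x y where xy: "v = (x, y)" by (cases v)
    have h: "x + y \<le> m + n" "height U (x + y) = y" "height L (x + y) = y"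
      using v len by (auto simp: xy mem_vertices)
    then have "x + y = 0 \<or> x + y = m + n"
      using * by (metis gr0I le_neq_implies_less less_irrefl)
    then show "v \<in> {(0, 0), (m, n)}"
      using h UL len by (auto simp: xy lattice_paths_def)
  next
    fix v assume "v \<in> {(0, 0), (m, n)}"
    then show "v \<in> vertices U \<inter> vertices L"
      using UL len by (auto simp: mem_vertices lattice_paths_def)
  qed
  then show "(U, L) \<in> Polyo m n"
    using UL U L de by (auto simp: Polyo_def)
qed

definition height_sum :: "step list \<Rightarrow> nat" where
  "height_sum p = (\<Sum>k<length p. height p (Suc k))"

lemma height_sum_Nil [simp]: "height_sum [] = 0"
  by (simp add: height_sum_def)

lemma height_sum_Cons:
  "height_sum (d # p) = height_sum p + (if d = North then Suc (length p) else 0)"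
  unfolding height_sum_def length_Cons sum.lessThan_Suc_shift
  by (auto simp: sum_Suc)

lemma height_sum_append:
  "height_sum (p @ q) = height_sum p + height_sum q + count_list p North * length q"
  by (induction p) (auto simp: height_sum_Cons)

lemma area_height_sum:
  assumes "length U = length L" "count_list U North = count_list L North"
    and le: "\<And>k. height L k \<le> height U k"
  shows "area (U, L) + height_sum L = height_sum U"
proof -
  define K where "K = Sigma {..<length U} (\<lambda>k. {height L (Suc k)..<height U (Suc k)})"
  have "bij_betw (\<lambda>(k, y). (k - y, y)) K (squares (U, L))"
  proof (intro bij_betw_byWitness[where f' = "\<lambda>(x, y). (x + y, y)"])
    have y: "y \<le> k" if "y < height U (Suc k)" for k y
      using that height_le[of "Suc k" U] by linarith
    show "\<forall>a\<in>K. (case case a of (k, y) \<Rightarrow> (k - y, y) of (x, y) \<Rightarrow> (x + y, y)) = a"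
      by (auto simp: K_def le_add_diff_inverse2[OF y])
    show "\<forall>a'\<in>squares (U, L). (case case a' of (x, y) \<Rightarrow> (x + y, y) of (k, y) \<Rightarrow> (k - y, y)) = a'"
      by auto
    show "(\<lambda>(k, y). (k - y, y)) ` K \<subseteq> squares (U, L)"
      unfolding squares_height[OF assms(2)] by (auto simp: K_def le_add_diff_inverse2[OF y])
    show "(\<lambda>(x, y). (x + y, y)) ` squares (U, L) \<subseteq> K"
    proof -
      have "x + y < length U"
        if "height L (Suc (x + y)) \<le> y" "y < height U (Suc (x + y))" for x y
      proof (rule ccontr)
        assume "\<not> x + y < length U"
        then have "height L (Suc (x + y)) = height U (Suc (x + y))"
          using assms by simp
        then show False using that by simp
      qed
      then show ?thesis
        unfolding squares_height[OF assms(2)] by (auto simp: K_def)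
    qed
  qed
  then have "area (U, L) = card K"
    unfolding area_def by (simp add: bij_betw_same_card)
  also have "\<dots> = (\<Sum>k<length U. height U (Suc k) - height L (Suc k))"
    by (simp add: K_def)
  finally have "area (U, L) + height_sum L =
      (\<Sum>k<length U. height U (Suc k) - height L (Suc k) + height L (Suc k))"
    by (simp add: height_sum_def assms(1) sum.distrib)
  also have "\<dots> = height_sum U"
    unfolding height_sum_def using le by (intro sum.cong) auto
  finally show ?thesis .
qed

section \<open>The area word\<close>

lemma step_less_length:
  assumes "length U = length L" "count_list U North = count_list L North"
    and "height L (Suc k) < height U (Suc k)"
  shows "Suc k < length U"
proof (rule ccontr)
  assume "\<not> Suc k < length U"
  with assms show False by simp
qed

lemma line_length_vertex:
  assumes "length U = length L" "k \<le> length L" "height L k \<le> height U k"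
  shows "line_length U (vertex L k) = height U k - height L k"
proof -
  have "k - height L k - i + (height L k + i) = k" if "i \<le> k - height L k" for i
    using that height_le[of k L] by simp
  then have "i \<le> k - height L k \<and> (k - height L k - i, height L k + i) \<in> vertices U \<longleftrightarrow>
      i = height U k - height L k" for i
    using assms height_le[of k U] height_le[of k L] by (auto simp: mem_vertices)
  then show ?thesis
    unfolding line_length_def vertex_height[OF assms(2)] prod.case
    by (intro Least_equality) auto
qed

lemma mem_crossed:
  assumes "length U = length L" "k < length L" "height L (Suc k) \<le> height U (Suc k)"
  shows "(x, y) \<in> crossed U (vertex L (Suc k)) \<longleftrightarrow>
    x + y = k \<and> height L (Suc k) \<le> y \<and> y < height U (Suc k)"
proof -
  define a b where "a = height L (Suc k)" and "b = height U (Suc k)"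
  have ab: "a \<le> b" "b \<le> Suc k" using assms height_le by (auto simp: a_def b_def)
  have *: "line_length U (Suc k - a, a) = b - a"
    using line_length_vertex[of U L "Suc k"] assms by (simp add: vertex_height a_def b_def)
  have "vertex L (Suc k) = (Suc k - a, a)" using assms by (simp add: vertex_height a_def)
  then have "(x, y) \<in> crossed U (vertex L (Suc k)) \<longleftrightarrow>
      (\<exists>i < b - a. x = Suc k - a - Suc i \<and> y = a + i)"
    by (auto simp: crossed_def *)
  also have "\<dots> \<longleftrightarrow> x + y = k \<and> a \<le> y \<and> y < b"
  proof
    assume "x + y = k \<and> a \<le> y \<and> y < b"
    then show "\<exists>i < b - a. x = Suc k - a - Suc i \<and> y = a + i"
      by (intro exI[of _ "y - a"]) auto
  qed (use ab in auto)
  finally show ?thesis by (simp add: a_def b_def)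
qed

lemma lower_label_eq:
  assumes "length U = length L" "k < length L" "height L (Suc k) \<le> height U (Suc k)"
  shows "lower_label (U, L) k = Plain (height U (Suc k) - height L (Suc k))"
proof -
  obtain x y where v: "vertex L (Suc k) = (x, y)" by (cases "vertex L (Suc k)")
  have "crossed U (x, y) = (\<lambda>i. (x - Suc i, y + i)) ` {..<line_length U (x, y)}"
    by (auto simp: crossed_def)
  also have "card \<dots> = line_length U (x, y)"
    by (subst card_image) (auto simp: inj_on_def)
  finally show ?thesis
    using line_length_vertex[of U L "Suc k"] assms by (simp add: v)
qed

lemma upper_label_eq:
  assumes "length U = length L" "count_list U North = count_list L North"
    and le: "\<And>k. height L k \<le> height U k"
    and k: "k < length U" "U ! k = North"
  shows "upper_label (U, L) k = Bar (height U k - height L k)"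
proof -
  define S where "S = {s \<in> squares (U, L). snd s = height U k \<and>
                        s \<notin> (\<Union>e \<in> end_points East L. crossed U e)}"
  have S: "(x, y) \<in> S \<longleftrightarrow> y = height U k \<and> x + y < length L \<and> k \<le> x + y \<and>
      L ! (x + y) = North \<and> height L (x + y) < y" for x y
  proof (cases "(x, y) \<in> squares (U, L) \<and> y = height U k")
    case True
    then have h: "height L (Suc (x + y)) \<le> y" "y < height U (Suc (x + y))" "y = height U k"
      unfolding squares_height[OF assms(2)] by auto
    then have l: "x + y < length L"
      using step_less_length[OF assms(1,2), of "x + y"] assms(1) by simp
    have "k \<le> x + y"
    proof (rule ccontr)
      assume "\<not> k \<le> x + y"
      then show False using height_mono[of "Suc (x + y)" k U] h by simp
    qed
    moreover have "(x, y) \<in> (\<Union>e \<in> end_points East L. crossed U e) \<longleftrightarrow> L ! (x + y) = East"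
    proof
      assume "(x, y) \<in> (\<Union>e \<in> end_points East L. crossed U e)"
      then obtain j where "j < length L" "L ! j = East" "(x, y) \<in> crossed U (vertex L (Suc j))"
        by (auto simp: end_points_def)
      then show "L ! (x + y) = East"
        using mem_crossed[OF assms(1) _ le] by auto
    next
      assume "L ! (x + y) = East"
      then have "vertex L (Suc (x + y)) \<in> end_points East L"
        unfolding end_points_def using l by blast
      moreover have "(x, y) \<in> crossed U (vertex L (Suc (x + y)))"
        using mem_crossed[OF assms(1) l le] h by auto
      ultimately show "(x, y) \<in> (\<Union>e \<in> end_points East L. crossed U e)" by blast
    qed
    then have "(x, y) \<in> S \<longleftrightarrow> L ! (x + y) \<noteq> East"
      using True unfolding S_def mem_Collect_eq snd_conv by blast
    then have "(x, y) \<in> S \<longleftrightarrow> L ! (x + y) = North"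
      by (cases "L ! (x + y)") auto
    ultimately show ?thesis
      using h l by (auto simp: height_Suc)
  next
    case False
    then have "(x, y) \<notin> S" by (auto simp: S_def)
    moreover have "(x, y) \<in> squares (U, L)"
      if "y = height U k" "x + y < length L" "k \<le> x + y" "L ! (x + y) = North"
        "height L (x + y) < y"
      using that height_North_less[of k "Suc (x + y)" U] k
      unfolding squares_height[OF assms(2)] by (simp add: height_Suc)
    ultimately show ?thesis using False by blast
  qed
  have "bij_betw (\<lambda>(x, y). height L (x + y)) S {height L k..<height U k}"
  proof (intro bij_betw_imageI subset_antisym subsetI)
    show "inj_on (\<lambda>(x, y). height L (x + y)) S"
    proof (intro inj_onI, clarify)
      fix a b c d assume ab: "(a, b) \<in> S" and cd: "(c, d) \<in> S"
        and eq: "height L (a + b) = height L (c + d)"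
      note ab = ab[unfolded S] and cd = cd[unfolded S]
      then have "\<not> a + b < c + d" "\<not> c + d < a + b"
        using height_North_less[of "a + b" "c + d" L] height_North_less[of "c + d" "a + b" L] eq
        by linarith+
      then show "a = c \<and> b = d" using ab cd by simp
    qed
  next
    fix z assume "z \<in> (\<lambda>(x, y). height L (x + y)) ` S"
    then obtain x y where "z = height L (x + y)" "(x, y) \<in> S" by auto
    then show "z \<in> {height L k..<height U k}"
      using height_mono[of k "x + y" L] by (auto simp: S)
  next
    fix z assume z: "z \<in> {height L k..<height U k}"
    then have "z < height L (length L)"
      using height_le_count[of k U] assms(2) by simp
    then obtain j where j: "j < length L" "L ! j = North" "height L j = z"
      using height_attained by blast
    then have "k \<le> j" using height_North_less[of j k L] z by (meson atLeastLessThan_iff not_less)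
    then have "(j - height U k, height U k) \<in> S" "j - height U k + height U k = j"
      using j z height_le[of k U] by (auto simp: S)
    then show "z \<in> (\<lambda>(x, y). height L (x + y)) ` S"
      using j by force
  qed
  then have "card S = height U k - height L k"
    by (simp add: bij_betw_same_card)
  then show ?thesis
    using k by (simp add: S_def vertex_height)
qed

text \<open>The area word read step by step, where \<open>g\<close> is the current difference between the heights of the
  upper and the lower path: the labels are \<open>Bar g\<close> for the difference before the step and \<open>Plain g\<close>
  for the difference after it.\<close>

fun gap_word :: "nat \<Rightarrow> step list \<Rightarrow> step list \<Rightarrow> nat list" where
  "gap_word g (North # U) (North # L) = 2 * g # gap_word g U L"
| "gap_word g (North # U) (East # L) = 2 * g # Suc (2 * g) # gap_word (Suc g) U L"
| "gap_word g (East # U) (North # L) = gap_word (g - 1) U L"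
| "gap_word g (East # U) (East # L) = (2 * g - 1) # gap_word g U L"
| "gap_word g _ _ = []"

fun stays_above :: "nat \<Rightarrow> step list \<Rightarrow> step list \<Rightarrow> bool" where
  "stays_above g [] [] \<longleftrightarrow> g = 0"
| "stays_above g (North # U) (North # L) \<longleftrightarrow> 0 < g \<and> stays_above g U L"
| "stays_above g (North # U) (East # L) \<longleftrightarrow> 0 < g \<and> stays_above (Suc g) U L"
| "stays_above g (East # U) (North # L) \<longleftrightarrow> 0 < g \<and> stays_above (g - 1) U L"
| "stays_above g (East # U) (East # L) \<longleftrightarrow> 0 < g \<and> stays_above g U L"
| "stays_above g _ _ \<longleftrightarrow> False"

lemma stays_aboveI:
  assumes "length U = length L" "g + count_list U North = count_list L North"
    and "\<And>k. k < length U \<Longrightarrow> height L k < g + height U k"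
  shows "stays_above g U L"
  using assms
proof (induction g U L rule: stays_above.induct)
  case (2 g U L)
  have "height L k < g + height U k" if "k < length U" for k
    using 2(4)[of "Suc k"] that by simp
  then have "stays_above g U L" using 2(2,3) by (intro 2(1)) auto
  then show ?case using 2(4)[of 0] by simp
next
  case (3 g U L)
  have "height L k < Suc g + height U k" if "k < length U" for k
    using 3(4)[of "Suc k"] that by simp
  then have "stays_above (Suc g) U L" using 3(2,3) by (intro 3(1)) auto
  then show ?case using 3(4)[of 0] by simp
next
  case (4 g U L)
  have g: "0 < g" using 4(4)[of 0] by simp
  have "height L k < g - 1 + height U k" if "k < length U" for k
    using 4(4)[of "Suc k"] that by simp
  then have "stays_above (g - 1) U L" using 4(2,3) g by (intro 4(1)) auto
  then show ?case using g by simp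
next
  case (5 g U L)
  have "height L k < g + height U k" if "k < length U" for k
    using 5(4)[of "Suc k"] that by simp
  then have "stays_above g U L" using 5(2,3) by (intro 5(1)) auto
  then show ?case using 5(4)[of 0] by simp
qed auto

text \<open>The letter \<open>Plain 0\<close> is not in the range.\<close>

definition letter_of :: "nat \<Rightarrow> letter" where
  "letter_of i = (if even i then Bar (i div 2) else Plain (Suc (i div 2)))"

lemma letter_less_letter_of: "letter_less (letter_of i) (letter_of j) \<longleftrightarrow> i < j"
  by (auto simp: letter_of_def elim!: evenE oddE)

lemma letter_of_cases: "c = Plain 0 \<or> (\<exists>k. c = letter_of k)"
proof (cases c)
  case (Bar k)
  then have "c = letter_of (2 * k)" by (simp add: letter_of_def)
  then show ?thesis by blast
next
  case (Plain k)
  then have "k = 0 \<or> c = letter_of (2 * k - 1)"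
    by (cases k) (auto simp: letter_of_def)
  then show ?thesis using Plain by blast
qed

lemma immediate_succ_letter_of: "immediate_succ (letter_of i) (letter_of j) \<longleftrightarrow> j = Suc i"
proof -
  have "\<not> letter_less a (Plain 0)" for a by (cases a) auto
  then have "(\<exists>c. letter_less (letter_of i) c \<and> letter_less c (letter_of j)) \<longleftrightarrow>
      (\<exists>k. i < k \<and> k < j)"
    by (metis letter_less_letter_of letter_of_cases)
  also have "\<dots> \<longleftrightarrow> Suc i < j" by (auto intro: Suc_lessI)
  finally show ?thesis
    unfolding immediate_succ_def by (auto simp: letter_less_letter_of)
qed

lemma gap_word_labels:
  assumes "stays_above g U L"
  shows "concat (map (\<lambda>k.
      (if U ! k = North then [Bar (g + height U k - height L k)] else []) @
      (if L ! k = East then [Plain (g + height U (Suc k) - height L (Suc k))] else []))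
      [0..<length U]) = map letter_of (gap_word g U L)"
  using assms
proof (induction g U L rule: stays_above.induct)
  case (4 g U L)
  then have *: "g - Suc 0 + a - b = g + a - Suc b" for a b by simp
  show ?case
    using 4 by (simp add: upt_conv_Cons map_Suc_upt[symmetric] o_def * del: upt_Suc cong: if_cong)
next
  case (5 g U L)
  then obtain g' where g: "g = Suc g'" by (cases g) auto
  show ?case
    using 5 unfolding g by (simp add: upt_conv_Cons map_Suc_upt[symmetric] o_def letter_of_def
      del: upt_Suc cong: if_cong)
qed (simp_all add: upt_conv_Cons map_Suc_upt[symmetric] o_def letter_of_def
  del: upt_Suc cong: if_cong)

lemma stays_above_length: "stays_above g U L \<Longrightarrow> length U = length L"
  by (induction g U L rule: stays_above.induct) auto

lemma Polyo_counts:
  assumes "(U, L) \<in> Polyo m n"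
  shows "length U = m + n" "length L = m + n" "count_list U North = n" "count_list L North = n"
    "count_list U East = m" "count_list L East = m"
proof -
  have "U \<in> lattice_paths m n" "L \<in> lattice_paths m n"
    using assms unfolding Polyo_def by blast+
  then show "length U = m + n" "length L = m + n" "count_list U North = n" "count_list L North = n"
    "count_list U East = m" "count_list L East = m"
    by (auto simp: length_lattice_path) (auto simp: lattice_paths_def)
qed

lemma Polyo_height_less:
  assumes "m \<ge> 1" "n \<ge> 1" "(U, L) \<in> Polyo m n" "0 < k" "k < m + n"
  shows "height L k < height U k"
  using Polyo_iff[THEN iffD1, OF assms(1-3)] assms(4,5) by blast

lemma Polyo_stays_above:
  assumes "m \<ge> 1" "n \<ge> 1" "(U, L) \<in> Polyo m n"
  obtains U' L' where "U = North # U'" "L = East # L'" "stays_above 1 U' L'"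
proof -
  note P = Polyo_counts[OF assms(3)]
  obtain U' L' where UL: "U = North # U'" "L = East # L'"
  proof
    have "U \<noteq> []" "hd U = North" "L \<noteq> []" "hd L = East"
      using assms(3) unfolding Polyo_def by blast+
    then show "U = North # tl U" "L = East # tl L" by (metis list.collapse)+
  qed
  have "stays_above 1 U' L'"
  proof (rule stays_aboveI)
    show "length U' = length L'" "1 + count_list U' North = count_list L' North"
      using P by (simp_all add: UL)
    fix k assume "k < length U'"
    then have "Suc k < m + n" using P(1) by (simp add: UL)
    then have "height L (Suc k) < height U (Suc k)"
      using Polyo_height_less[OF assms] by blast
    then show "height L' k < 1 + height U' k" by (simp add: UL)
  qed
  with UL show ?thesis by (rule that)
qed

definition polyomino_word :: "polyomino \<Rightarrow> nat list" where
  "polyomino_word P = gap_word 0 (fst P) (snd P)"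

lemma Polyo_height_le:
  assumes "m \<ge> 1" "n \<ge> 1" "(U, L) \<in> Polyo m n"
  shows "height L k \<le> height U k"
proof (cases "0 < k \<and> k < m + n")
  case True
  then show ?thesis using Polyo_height_less[OF assms] by (simp add: less_imp_le)
next
  case False
  then show ?thesis using Polyo_counts[OF assms(3)] by auto
qed

lemma area_word_eq:
  assumes "m \<ge> 1" "n \<ge> 1" "P \<in> Polyo m n"
  shows "area_word P = map letter_of (polyomino_word P)"
proof -
  obtain U L where P: "P = (U, L)" by (cases P)
  note UL = assms(1,2) assms(3)[unfolded P]
  have len: "length U = length L" "count_list U North = count_list L North"
    using Polyo_counts[OF UL(3)] by simp_all
  have "area_word (U, L) = concat (map (\<lambda>k.
      (if U ! k = North then [Bar (height U k - height L k)] else []) @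
      (if L ! k = East then [Plain (height U (Suc k) - height L (Suc k))] else []))
      [0..<length U])"
    unfolding area_word.simps
  proof (intro arg_cong[where f = concat] map_cong refl arg_cong2[where f = append] if_cong)
    fix k assume "k \<in> set [0..<length U]"
    then have k: "k < length U" "k < length L" using len by auto
    show "[upper_label (U, L) k] = [Bar (height U k - height L k)]" if "U ! k = North"
      using upper_label_eq[OF len Polyo_height_le[OF UL] k(1) that] by simp
    show "[lower_label (U, L) k] = [Plain (height U (Suc k) - height L (Suc k))]"
      using lower_label_eq[OF len(1) k(2) Polyo_height_le[OF UL]] by simp
  qed
  also have "\<dots> = map letter_of (polyomino_word (U, L))"
  proof -
    obtain U' L' where U': "U = North # U'" "L = East # L'" "stays_above 1 U' L'"
      using Polyo_stays_above[OF UL] .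
    show ?thesis
      using gap_word_labels[OF U'(3)]
      by (simp add: U'(1,2) polyomino_word_def upt_conv_Cons map_Suc_upt[symmetric] o_def
          letter_of_def del: upt_Suc cong: if_cong)
  qed
  finally show ?thesis by (simp add: P)
qed

fun succ_pairs :: "nat list \<Rightarrow> nat" where
  "succ_pairs [] = 0"
| "succ_pairs (x # w) = count_list w (Suc x) + succ_pairs w"

lemma card_nth_eq: "card {j. j < length w \<and> w ! j = x} = count_list w x"
  by (simp add: count_list_eq_length_filter length_filter_conv_card eq_commute)

lemma card_succ_pairs:
  "card {(i, j). i < j \<and> j < length w \<and> w ! j = Suc (w ! i)} = succ_pairs w"
proof (induction w)
  case (Cons x w)
  let ?S = "{(i, j). i < j \<and> j < length w \<and> w ! j = Suc (w ! i)}"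
  let ?T = "{j. j < length w \<and> w ! j = Suc x}"
  have "{(i, j). i < j \<and> j < length (x # w) \<and> (x # w) ! j = Suc ((x # w) ! i)} =
      (\<lambda>j. (0, Suc j)) ` ?T \<union> map_prod Suc Suc ` ?S" (is "?A = ?B")
  proof (intro set_eqI)
    fix p :: "nat \<times> nat"
    obtain i j where p: "p = (i, j)" by (cases p)
    show "p \<in> ?A \<longleftrightarrow> p \<in> ?B"
      by (cases i; cases j) (auto simp: p image_iff)
  qed
  moreover have "finite ?S"
    by (rule finite_subset[of _ "{..<length w} \<times> {..<length w}"]) auto
  moreover have "card ((\<lambda>j. (0::nat, Suc j)) ` ?T) = card ?T"
    by (intro card_image) (auto simp: inj_on_def)
  moreover have "card (map_prod Suc Suc ` ?S) = card ?S"
    by (intro card_image) (auto simp: inj_on_def)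
  moreover have "(\<lambda>j. (0, Suc j)) ` ?T \<inter> map_prod Suc Suc ` ?S = {}" by auto
  ultimately show ?case
    using Cons.IH by (simp add: card_Un_disjoint card_nth_eq)
qed simp

lemma dinv_eq_succ_pairs:
  assumes "m \<ge> 1" "n \<ge> 1" "P \<in> Polyo m n"
  shows "dinv P = succ_pairs (polyomino_word P)"
proof -
  have "dinv P = card {(i, j). i < j \<and> j < length (polyomino_word P) \<and>
      polyomino_word P ! j = Suc (polyomino_word P ! i)}"
    unfolding dinv_def area_word_eq[OF assms]
    by (intro arg_cong[where f = card] Collect_cong)
      (auto simp: immediate_succ_letter_of)
  then show ?thesis by (simp add: card_succ_pairs)
qed

lemma gap_word_sum:
  assumes "stays_above g U L"
  shows "2 * int (\<Sum>x\<leftarrow>gap_word g U L. Suc x div 2) + int g * (int g - 1) + 2 * int (height_sum L) =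
    2 * int (height_sum U) + 2 * int g * int (length U)"
  using assms
proof (induction g U L rule: stays_above.induct)
  case (2 g U L)
  then show ?case using stays_above_length[of g U L] by (simp add: height_sum_Cons algebra_simps)
next
  case (3 g U L)
  then show ?case using stays_above_length[of "Suc g" U L] by (simp add: height_sum_Cons algebra_simps)
next
  case (4 g U L)
  then obtain g' where "g = Suc g'" by (cases g) auto
  then show ?case
    using 4 stays_above_length[of g' U L] by (simp add: height_sum_Cons algebra_simps)
next
  case (5 g U L)
  then obtain g' where "g = Suc g'" by (cases g) auto
  then show ?case using 5 by (simp add: height_sum_Cons algebra_simps)
qed auto

lemma area_eq_word_sum:
  assumes "m \<ge> 1" "n \<ge> 1" "P \<in> Polyo m n"
  shows "area P = (\<Sum>x\<leftarrow>polyomino_word P. Suc x div 2)"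
proof -
  obtain U L where P: "P = (U, L)" by (cases P)
  note UL = assms(1,2) assms(3)[unfolded P]
  have len: "length U = length L" "count_list U North = count_list L North"
    using Polyo_counts[OF UL(3)] by simp_all
  obtain U' L' where U': "U = North # U'" "L = East # L'" "stays_above 1 U' L'"
    using Polyo_stays_above[OF UL] .
  have "area (U, L) + height_sum L = height_sum U"
    using area_height_sum[OF len Polyo_height_le[OF UL]] .
  then show ?thesis
    using gap_word_sum[OF U'(3)] by (simp add: U'(1,2) height_sum_Cons P polyomino_word_def)
qed

definition area_words :: "nat \<Rightarrow> nat \<Rightarrow> nat list set" where
  "area_words e d = {w. w \<noteq> [] \<and> hd w = 0 \<and> 0 \<notin> set (tl w) \<and>
     successively (\<lambda>x y. y \<le> Suc x) w \<and>
     length (filter even w) = e \<and> length (filter odd w) = d}"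

lemma gap_word_successively:
  assumes "stays_above g U L" "2 * g \<le> Suc x"
  shows "successively (\<lambda>x y. y \<le> Suc x) (x # gap_word g U L)"
  using assms
proof (induction g U L arbitrary: x rule: stays_above.induct)
  case (5 g U L)
  then show ?case using "5.IH"[of "2 * g - 1"] by (cases g) auto
qed auto

lemma gap_word_nonzero: "stays_above g U L \<Longrightarrow> 0 \<notin> set (gap_word g U L)"
  by (induction g U L rule: stays_above.induct) auto

lemma gap_word_filter_even:
  "stays_above g U L \<Longrightarrow> length (filter even (gap_word g U L)) = count_list U North"
  by (induction g U L rule: stays_above.induct) (auto elim: oddE)

lemma gap_word_filter_odd:
  "stays_above g U L \<Longrightarrow> length (filter odd (gap_word g U L)) = count_list L East"
  by (induction g U L rule: stays_above.induct) (auto elim: oddE)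

lemma polyomino_word_mem:
  assumes "m \<ge> 1" "n \<ge> 1" "P \<in> Polyo m n"
  shows "polyomino_word P \<in> area_words n m"
proof -
  obtain U L where P: "P = (U, L)" by (cases P)
  note UL = assms(1,2) assms(3)[unfolded P]
  obtain U' L' where U': "U = North # U'" "L = East # L'" "stays_above 1 U' L'"
    using Polyo_stays_above[OF UL] .
  have "count_list U North = n" "count_list L East = m"
    using Polyo_counts[OF UL(3)] by simp_all
  then show ?thesis
    using gap_word_successively[OF U'(3), of 1] gap_word_nonzero[OF U'(3)]
      gap_word_filter_even[OF U'(3)] gap_word_filter_odd[OF U'(3)]
    by (simp add: area_words_def polyomino_word_def P U'(1,2))
qed

lemma gap_word_hd_le:
  assumes "stays_above g U L" "gap_word g U L = y # w"
  shows "y \<le> 2 * g"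
proof (cases g)
  case 0
  with assms show ?thesis by (cases "(g, U, L)" rule: stays_above.cases) auto
next
  case (Suc g')
  then show ?thesis
    using gap_word_successively[OF assms(1), of "2 * g - 1"] assms(2) by simp
qed

lemma gap_word_neq: "stays_above g U L \<Longrightarrow> 2 * g < y \<Longrightarrow> gap_word g U L \<noteq> y # w"
  using gap_word_hd_le by fastforce

lemma gap_word_inj:
  assumes "stays_above g U L" "stays_above g U' L'" "gap_word g U L = gap_word g U' L'"
  shows "U = U' \<and> L = L'"
  using assms
proof (induction g U L arbitrary: U' L' rule: stays_above.induct)
  case 1
  then show ?case by (cases "(0 :: nat, U', L')" rule: stays_above.cases) auto
next
  case (2 g U L)
  show ?case
    using 2(2-4) 2(1)[of "tl U'" "tl L'"]
    by (cases "(g, U', L')" rule: stays_above.cases)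
      (simp_all add: gap_word_neq gap_word_neq[symmetric])
next
  case (3 g U L)
  show ?case
    using 3(2-4) 3(1)[of "tl U'" "tl L'"]
    by (cases "(g, U', L')" rule: stays_above.cases)
      (simp_all add: gap_word_neq gap_word_neq[symmetric])
next
  case (4 g U L)
  then have "2 * (g - 1) < 2 * g - 1" by simp arith
  then have "gap_word (g - 1) U L \<noteq> (2 * g - 1) # w" "gap_word (g - 1) U L \<noteq> 2 * g # w" for w
    using gap_word_neq[of "g - 1" U L "2 * g - 1" w] gap_word_neq[of "g - 1" U L "2 * g" w] 4(2)
    by auto
  then show ?case
    using 4(2-4) 4(1)[of "tl U'" "tl L'"]
    by (cases "(g, U', L')" rule: stays_above.cases) auto
next
  case (5 g U L)
  have "2 * g - Suc 0 \<noteq> 2 * g" "2 * g \<noteq> 2 * g - Suc 0" using 5(2) by auto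
  then show ?case
    using 5(2-4) 5(1)[of "tl U'" "tl L'"]
    by (cases "(g, U', L')" rule: stays_above.cases)
      (simp_all add: gap_word_neq gap_word_neq[symmetric])
qed auto

lemma polyomino_word_inj:
  assumes "m \<ge> 1" "n \<ge> 1"
  shows "inj_on polyomino_word (Polyo m n)"
proof (rule inj_onI)
  fix P Q assume PQ: "P \<in> Polyo m n" "Q \<in> Polyo m n" "polyomino_word P = polyomino_word Q"
  obtain U L V M where P: "P = (U, L)" "Q = (V, M)" by (cases P, cases Q)
  obtain U' L' where U': "U = North # U'" "L = East # L'" "stays_above 1 U' L'"
    using Polyo_stays_above[OF assms PQ(1)[unfolded P]] .
  obtain V' M' where V': "V = North # V'" "M = East # M'" "stays_above 1 V' M'"
    using Polyo_stays_above[OF assms PQ(2)[unfolded P]] .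
  have "gap_word 1 U' L' = gap_word 1 V' M'"
    using PQ(3) by (simp add: P U'(1,2) V'(1,2) polyomino_word_def)
  then show "P = Q"
    using gap_word_inj[OF U'(3) V'(3)] by (simp add: P U'(1,2) V'(1,2))
qed

section \<open>The polyomino of a word\<close>

definition dir :: "nat \<Rightarrow> step" where
  "dir i = (if even i then East else North)"

lemma dir_Suc_neq [simp]: "dir (Suc i) \<noteq> dir i" "dir i \<noteq> dir (Suc i)"
  by (auto simp: dir_def)

lemma dir_Suc_Suc [simp]: "dir (Suc (Suc i)) = dir i"
  by (simp add: dir_def)

definition segment :: "nat list \<Rightarrow> nat \<Rightarrow> step list" where
  "segment w i = map dir (rev (filter (\<lambda>x. x = i \<or> x = Suc i) w))"

primrec segments :: "nat list \<Rightarrow> nat \<Rightarrow> nat \<Rightarrow> step list" where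
  "segments w 0 i = []"
| "segments w (Suc b) i = segment w i @ segments w b (Suc (Suc i))"

primrec blocks :: "nat list \<Rightarrow> nat \<Rightarrow> nat \<Rightarrow> step list" where
  "blocks w 0 i = []"
| "blocks w (Suc b) i = replicate (count_list w i) (dir i) @ blocks w b (Suc i)"

definition word_polyomino :: "nat list \<Rightarrow> polyomino" where
  "word_polyomino w = (segments w (length w) 0, East # segments w (length w) 1)"

lemma count_list_replicate: "count_list (replicate k d) e = (if d = e then k else 0)"
  by (induction k) auto

lemma length_filter_disjoint:
  assumes "\<And>x. x \<in> set w \<Longrightarrow> P x \<longleftrightarrow> Q x \<or> R x" "\<And>x. \<not> (Q x \<and> R x)"
  shows "length (filter P w) = length (filter Q w) + length (filter R w)"
  using assms(1)
proof (induction w)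
  case (Cons x w)
  have "P x \<longleftrightarrow> Q x \<or> R x" "length (filter P w) = length (filter Q w) + length (filter R w)"
    using Cons by auto
  then show ?case using assms(2)[of x] by auto
qed simp

lemma count_list_map_filter:
  "count_list (map f (filter P w)) d = length (filter (\<lambda>x. P x \<and> f x = d) w)"
  by (induction w) auto

lemma count_list_rev: "count_list (rev w) d = count_list w d"
  by (induction w) auto

lemma count_list_segment:
  "count_list (segment w i) d = length (filter (\<lambda>x. (x = i \<or> x = Suc i) \<and> dir x = d) w)"
  by (simp add: segment_def rev_map[symmetric] rev_filter[symmetric] count_list_rev
      count_list_map_filter)

lemma count_list_segments:
  "count_list (segments w b i) d = length (filter (\<lambda>x. i \<le> x \<and> x < i + 2 * b \<and> dir x = d) w)"
proof (induction b arbitrary: i)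
  case (Suc b)
  show ?case
    unfolding segments.simps count_list_append Suc.IH count_list_segment
    by (intro length_filter_disjoint[symmetric]) auto
qed simp

lemma count_list_filter: "count_list w x = length (filter (\<lambda>y. y = x) w)"
  by (induction w) auto

lemma count_list_blocks:
  "count_list (blocks w b i) d = length (filter (\<lambda>x. i \<le> x \<and> x < i + b \<and> dir x = d) w)"
proof (induction b arbitrary: i)
  case (Suc b)
  have "count_list (replicate (count_list w i) (dir i)) d =
      length (filter (\<lambda>x. x = i \<and> dir x = d) w)"
    by (induction w) (auto simp: count_list_replicate)
  then show ?case
    unfolding blocks.simps count_list_append Suc.IH
    by (subst length_filter_disjoint[where Q = "\<lambda>x. x = i \<and> dir x = d"
          and R = "\<lambda>x. Suc i \<le> x \<and> x < Suc i + b \<and> dir x = d"]) auto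
qed simp

lemma segments_add: "segments w (a + b) i = segments w a i @ segments w b (i + 2 * a)"
  by (induction a arbitrary: i) auto

lemma blocks_add: "blocks w (a + b) i = blocks w a i @ blocks w b (i + a)"
  by (induction a arbitrary: i) auto

lemma blocks_position:
  "k < length (blocks w b i) \<Longrightarrow>
    \<exists>j r. j < b \<and> r < count_list w (i + j) \<and> k = length (blocks w j i) + r"
proof (induction b arbitrary: i k)
  case (Suc b)
  show ?case
  proof (cases "k < count_list w i")
    case True
    then show ?thesis by (intro exI[of _ 0] exI[of _ k]) auto
  next
    case False
    then have "k - count_list w i < length (blocks w b (Suc i))" using Suc.prems by simp
    then obtain j r where "j < b" "r < count_list w (Suc i + j)"
      "k - count_list w i = length (blocks w j (Suc i)) + r"
      using Suc.IH by blast
    then show ?thesis using False by (intro exI[of _ "Suc j"] exI[of _ r]) auto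
  qed
qed simp

lemma length_eq_counts: "length p = count_list p d + count_list p e" if "d \<noteq> e" for p :: "step list"
  using that count_East_North[of p] by (cases d; cases e) auto

lemma length_counts_cong:
  "(\<And>d. count_list p d = count_list q d) \<Longrightarrow> length p = length q" for p :: "step list"
  using length_eq_counts[of East North] by simp

lemma successively_le:
  "successively (\<lambda>x y. y \<le> Suc x) (x # v) \<Longrightarrow> y \<in> set (x # v) \<Longrightarrow> y \<le> x + length v"
proof (induction v arbitrary: x)
  case (Cons z v)
  then show ?case using Cons.IH[of z] by fastforce
qed simp

text \<open>Climbing by steps of one, a word reaches \<open>i\<close> before \<open>i + 1\<close>.\<close>

lemma successively_first:
  assumes "successively (\<lambda>x y. y \<le> Suc x) (x # v)" "x \<le> i"
    and "filter (\<lambda>x. x = i \<or> x = Suc i) (x # v) = y # u"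
  shows "y = i"
  using assms
proof (induction v arbitrary: x)
  case (Cons z v)
  then show ?case using Cons.IH[of z] by (cases "x = i") auto
qed (auto split: if_splits)

locale area_word_like =
  fixes w :: "nat list"
  assumes w_nonempty: "w \<noteq> []" and w_hd: "hd w = 0" and w_tl: "0 \<notin> set (tl w)"
    and w_successively: "successively (\<lambda>x y. y \<le> Suc x) w"
begin

lemma count_0: "count_list w 0 = 1"
  using w_nonempty w_hd w_tl by (cases w) (auto simp: count_list_0_iff)

lemma letter_less_length: "x \<in> set w \<Longrightarrow> x < length w"
  using w_nonempty w_hd w_successively successively_le[of 0 "tl w" x] by (cases w) auto

lemma count_large: "length w \<le> i \<Longrightarrow> count_list w i = 0"
  using letter_less_length[of i] by (auto simp: count_list_0_iff)

lemma filter_first: "filter (\<lambda>x. x = i \<or> x = Suc i) w = y # u \<Longrightarrow> y = i"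
  using w_nonempty w_hd w_successively successively_first[of 0 "tl w" i y u] by (cases w) auto

lemma count_pos_Suc: "0 < count_list w (Suc i) \<Longrightarrow> 0 < count_list w i"
proof -
  assume "0 < count_list w (Suc i)"
  then have "Suc i \<in> set w" by (metis count_list_0_iff less_numeral_extra(3))
  then obtain y u where "filter (\<lambda>x. x = i \<or> x = Suc i) w = y # u"
    by (metis (mono_tags, lifting) filter_empty_conv list.exhaust)
  moreover from this have "y = i" by (rule filter_first)
  ultimately have "i \<in> set (filter (\<lambda>x. x = i \<or> x = Suc i) w)" by simp
  then have "i \<in> set w" by simp
  then show ?thesis by (metis count_list_0_iff gr0I)
qed

lemma count_pos: "0 < count_list w j \<Longrightarrow> i \<le> j \<Longrightarrow> 0 < count_list w i"
  by (induction j) (auto simp: le_Suc_eq dest: count_pos_Suc)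

lemma count_segment:
  "count_list (segment w i) (dir i) = count_list w i"
  "count_list (segment w i) (dir (Suc i)) = count_list w (Suc i)"
proof -
  have "(x = i \<or> x = Suc i) \<and> dir x = dir i \<longleftrightarrow> x = i"
    "(x = i \<or> x = Suc i) \<and> dir x = dir (Suc i) \<longleftrightarrow> x = Suc i" for x
    by auto
  then show "count_list (segment w i) (dir i) = count_list w i"
    "count_list (segment w i) (dir (Suc i)) = count_list w (Suc i)"
    by (simp_all only: count_list_segment count_list_filter[of w])
qed

lemma length_segment: "length (segment w i) = count_list w i + count_list w (Suc i)"
  using length_eq_counts[of "dir i" "dir (Suc i)" "segment w i"] by (simp add: count_segment)

lemma last_segment: "segment w i \<noteq> [] \<Longrightarrow> last (segment w i) = dir i"
  using filter_first[of i] unfolding segment_def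
  by (cases "filter (\<lambda>x. x = i \<or> x = Suc i) w") (auto simp: last_map)

lemma count_take_segment:
  assumes "r < length (segment w i)"
  shows "count_list (take r (segment w i)) (dir i) < count_list w i"
proof -
  have "drop r (segment w i) \<noteq> []" "last (drop r (segment w i)) = dir i"
    using assms last_segment[of i] by (force simp: last_drop)+
  then have "dir i \<in> set (drop r (segment w i))" by (metis last_in_set)
  then have "0 < count_list (drop r (segment w i)) (dir i)"
    by (metis count_list_0_iff gr0I)
  moreover have "count_list (take r (segment w i)) (dir i) +
      count_list (drop r (segment w i)) (dir i) = count_list w i"
    by (metis append_take_drop_id count_list_append count_segment(1))
  ultimately show ?thesis by simp
qed

definition upper :: "step list" where "upper = segments w (length w) 0"
definition lower :: "step list" where "lower = East # segments w (length w) 1"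
definition bounce_steps :: "step list" where "bounce_steps = blocks w (length w) 0"
definition path :: "nat \<Rightarrow> step list" where "path i = (if even i then upper else lower)"

lemma count_list_bounce_steps:
  "count_list bounce_steps d = length (filter (\<lambda>x. dir x = d) w)"
  unfolding bounce_steps_def count_list_blocks
  using letter_less_length by (auto intro!: arg_cong[where f = length] filter_cong)

lemma count_list_upper: "count_list upper d = length (filter (\<lambda>x. dir x = d) w)"
  unfolding upper_def count_list_segments
  using letter_less_length by (fastforce intro!: arg_cong[where f = length] filter_cong)

lemma count_list_lower: "count_list lower d = length (filter (\<lambda>x. dir x = d) w)"
proof -
  have "length (filter (\<lambda>x. dir x = d) w) = length (filter (\<lambda>x. x = 0 \<and> East = d) w) +
      length (filter (\<lambda>x. 1 \<le> x \<and> x < 1 + 2 * length w \<and> dir x = d) w)"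
  proof (intro length_filter_disjoint)
    fix x assume "x \<in> set w"
    then have "x = 0 \<or> 1 \<le> x \<and> x < 1 + 2 * length w"
      using letter_less_length[of x] by auto
    then show "dir x = d \<longleftrightarrow> x = 0 \<and> East = d \<or> 1 \<le> x \<and> x < 1 + 2 * length w \<and> dir x = d"
      by (auto simp: dir_def)
  qed auto
  also have "length (filter (\<lambda>x. x = 0 \<and> East = d) w) = count_list [East] d"
    using count_0 by (auto simp: count_list_filter)
  finally show ?thesis by (simp add: lower_def count_list_segments)
qed

lemma length_paths:
  "length bounce_steps = length w" "length upper = length w" "length lower = length w"
proof -
  have "length (filter (\<lambda>x. dir x = East) w) + length (filter (\<lambda>x. dir x = North) w) = length w"
    using length_filter_disjoint[of w "\<lambda>_. True" "\<lambda>x. dir x = East" "\<lambda>x. dir x = North"]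
    by (auto simp: dir_def)
  then show "length bounce_steps = length w" "length upper = length w" "length lower = length w"
    using count_East_North[of bounce_steps] count_East_North[of upper] count_East_North[of lower]
    unfolding count_list_bounce_steps count_list_upper count_list_lower by simp_all
qed

text \<open>Here \<open>pre\<close> ends in the same point as the first \<open>i\<close> runs of the bounce path: the upper path meets
  the bounce path at the beginning of even runs, the lower path at the beginning of odd runs.\<close>

lemma path_decomposition:
  assumes "0 < count_list w i"
  obtains pre post where "path i = pre @ segment w i @ post"
    "\<And>d. count_list pre d = count_list (blocks w i 0) d"
    "2 \<le> i \<Longrightarrow> pre \<noteq> [] \<and> last pre = dir i"
proof -
  define a where "a = i div 2"
  have "i < length w" using assms count_large[of i] by (cases "i < length w") auto
  then have "a < length w" by (simp add: a_def)
  then obtain b where b: "length w = a + Suc b"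
    using less_imp_Suc_add by auto
  define pre where "pre = (if even i then segments w a 0 else East # segments w a 1)"
  have i: "i = (if even i then 2 * a else Suc (2 * a))" by (auto simp: a_def)
  have "segments w (length w) j =
      segments w a j @ segment w (j + 2 * a) @ segments w b (Suc (Suc (j + 2 * a)))" for j
    unfolding b by (subst segments_add) simp
  then have "path i = pre @ segment w i @ segments w b (Suc (Suc i))"
    using i by (auto simp: path_def upper_def lower_def pre_def split: if_splits)
  moreover have "count_list pre d = count_list (blocks w i 0) d" for d
  proof (cases "even i")
    case True
    then show ?thesis using i by (simp add: pre_def count_list_segments count_list_blocks)
  next
    case False
    then have "blocks w i 0 = East # blocks w (2 * a) 1"
      using i count_0 by (simp add: dir_def)
    then show ?thesis using False by (simp add: pre_def count_list_segments count_list_blocks)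
  qed
  moreover have "pre \<noteq> [] \<and> last pre = dir i" if two: "2 \<le> i"
  proof -
    have "a \<noteq> 0" using two unfolding a_def by presburger
    then obtain a' where a': "a = Suc a'" by (cases a) auto
    obtain j where j: "i = Suc (Suc j)" using le_Suc_ex[OF two] by auto
    have split: "segments w a e = segments w a' e @ segment w (e + 2 * a')" for e
      using segments_add[of w a' 1 e] a' by simp
    have "\<exists>q. pre = q @ segment w j"
    proof (cases "even i")
      case True
      then have "j = 0 + 2 * a'" using i j a' by simp
      then show ?thesis using True split[of 0] by (simp add: pre_def)
    next
      case False
      then have "j = 1 + 2 * a'" using i j a' by simp
      then show ?thesis using False split[of 1] by (simp add: pre_def)
    qed
    then obtain q where q: "pre = q @ segment w j" ..
    have "0 < count_list w j" using count_pos[OF assms] j by simp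
    then have ne: "segment w j \<noteq> []" using length_segment[of j] by force
    then show ?thesis using last_segment[OF ne] j q by simp
  qed
  ultimately show ?thesis by (rule that)
qed

end

section \<open>The bounce path\<close>

context area_word_like
begin

lemma bounce_steps_decomposition:
  assumes "0 < count_list w i"
  obtains post where
    "bounce_steps = blocks w i 0 @ replicate (count_list w i) (dir i) @ post"
proof -
  have "i < length w" using assms count_large[of i] by (cases "i < length w") auto
  then obtain b where "length w = i + Suc b"
    using less_imp_Suc_add by auto
  then have "bounce_steps =
      blocks w i 0 @ replicate (count_list w i) (dir i) @ blocks w b (Suc i)"
    unfolding bounce_steps_def by (simp only: blocks_add) simp
  then show ?thesis by (rule that)
qed

lemma bounce_steps_position:
  assumes "k < length w"
  obtains i r where "r < count_list w i" "k = length (blocks w i 0) + r"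
  using assms blocks_position[of k w "length w" 0] length_paths(1)
  unfolding bounce_steps_def by auto

lemma take_bounce_steps:
  assumes "r \<le> count_list w i" "0 < count_list w i"
  shows "take (length (blocks w i 0) + r) bounce_steps = blocks w i 0 @ replicate r (dir i)"
proof -
  obtain post where "bounce_steps = blocks w i 0 @ replicate (count_list w i) (dir i) @ post"
    using bounce_steps_decomposition[OF assms(2)] .
  then show ?thesis using assms(1) by (simp add: min_def)
qed

lemma blocks_Suc_count:
  "count_list (blocks w (Suc i) 0) d = count_list (blocks w i 0) d + (if d = dir i then count_list w i else 0)"
  using blocks_add[of w i 1 0] by (simp add: count_list_replicate)

lemma length_blocks_Suc: "length (blocks w (Suc i) 0) = length (blocks w i 0) + count_list w i"
  using blocks_add[of w i 1 0] by simp

lemma path_le_bounce: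
  assumes "r < count_list w i" "k = length (blocks w i 0) + r"
  shows "count_list (take k (path i)) (dir i) \<le> count_list (take k bounce_steps) (dir i)"
proof -
  have pos: "0 < count_list w i" using assms by simp
  obtain pre post where p: "path i = pre @ segment w i @ post"
    "\<And>d. count_list pre d = count_list (blocks w i 0) d"
    using path_decomposition[OF pos] by metis
  have "length pre = length (blocks w i 0)" using p(2) by (rule length_counts_cong)
  then have "take k (path i) = pre @ take r (segment w i @ post)"
    using assms(2) p(1) by simp
  moreover have "count_list (take r (segment w i @ post)) (dir i) \<le> r"
    by (metis count_le_length le_trans length_take min.cobounded2)
  moreover have "take k bounce_steps = blocks w i 0 @ replicate r (dir i)"
    using take_bounce_steps[of r i] assms by simp
  ultimately show ?thesis
    by (simp add: p(2) count_list_replicate)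
qed

lemma path_less_bounce:
  assumes "r < count_list w (Suc i)" "k = length (blocks w (Suc i) 0) + r"
  shows "count_list (take k (path i)) (dir i) < count_list (take k bounce_steps) (dir i)"
proof -
  have pos: "0 < count_list w (Suc i)" using assms by simp
  obtain pre post where p: "path i = pre @ segment w i @ post"
    "\<And>d. count_list pre d = count_list (blocks w i 0) d"
    using path_decomposition[OF count_pos_Suc[OF pos]] by metis
  have "length pre = length (blocks w i 0)" using p(2) by (rule length_counts_cong)
  moreover have "count_list w i + r < length (segment w i)"
    using assms(1) by (simp add: length_segment)
  ultimately have "take k (path i) = pre @ take (count_list w i + r) (segment w i)"
    using assms(2) p(1) by (simp add: length_blocks_Suc del: blocks.simps)
  moreover have "count_list (take (count_list w i + r) (segment w i)) (dir i) < count_list w i"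
    by (rule count_take_segment) fact
  moreover have "take k bounce_steps = blocks w (Suc i) 0 @ replicate r (dir (Suc i))"
    using take_bounce_steps[of r "Suc i"] assms by simp
  ultimately show ?thesis
    by (simp add: p(2) count_list_replicate blocks_Suc_count del: blocks.simps)
qed

lemma height_less_iff:
  assumes "length p = length q"
  shows "count_list (take k p) East < count_list (take k q) East \<longleftrightarrow> height q k < height p k"
    "count_list (take k p) East \<le> count_list (take k q) East \<longleftrightarrow> height q k \<le> height p k"
  using count_East_North[of "take k p"] count_East_North[of "take k q"] assms by auto

lemma bounce_position_pos:
  assumes "0 < k" "k < length w"
  obtains i r where "r < count_list w (Suc i)" "k = length (blocks w (Suc i) 0) + r"
proof -
  obtain j r where j: "r < count_list w j" "k = length (blocks w j 0) + r"
    using bounce_steps_position[OF assms(2)] .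
  then show ?thesis
    using that[of r "j - 1"] assms(1) count_0 by (cases j) auto
qed

lemma lower_below_upper:
  assumes "0 < k" "k < length w"
  shows "height lower k < height upper k"
proof -
  obtain i r where k: "r < count_list w (Suc i)" "k = length (blocks w (Suc i) 0) + r"
    using bounce_position_pos[OF assms] .
  note less = path_less_bounce[OF k] and le = path_le_bounce[OF k]
  show ?thesis
  proof (cases "even i")
    case True
    then have "height bounce_steps k < height upper k"
      using less height_less_iff[of upper bounce_steps k]
      by (simp add: path_def dir_def length_paths)
    moreover have "height lower k \<le> height bounce_steps k"
      using le True by (simp add: path_def dir_def)
    ultimately show ?thesis by simp
  next
    case False
    then have "height bounce_steps k \<le> height upper k"
      using le height_less_iff[of upper bounce_steps k]
      by (simp add: path_def dir_def length_paths)
    moreover have "height lower k < height bounce_steps k"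
      using less False by (simp add: path_def dir_def)
    ultimately show ?thesis by simp
  qed
qed

lemma word_polyomino_eq: "word_polyomino w = (upper, lower)"
  by (simp add: word_polyomino_def upper_def lower_def)

lemma word_polyomino_Polyo:
  assumes "length (filter even w) = m" "length (filter odd w) = n" "m \<ge> 1" "n \<ge> 1"
  shows "word_polyomino w \<in> Polyo m n"
proof -
  have "dir x = East \<longleftrightarrow> even x" "dir x = North \<longleftrightarrow> odd x" for x
    by (auto simp: dir_def)
  then have "upper \<in> lattice_paths m n" "lower \<in> lattice_paths m n"
    using assms(1,2) by (simp_all add: lattice_paths_def count_list_upper count_list_lower)
  moreover from this have "m + n = length w"
    using length_lattice_path length_paths(2) by metis
  ultimately show ?thesis
    using lower_below_upper by (simp add: word_polyomino_eq Polyo_iff[OF assms(3,4)])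
qed

lemma turn_dir:
  "turn upper lower (dir (Suc i)) v =
    (if v \<in> end_points (dir i) (path i) then dir i else dir (Suc i))"
  by (auto simp: dir_def path_def)

lemma turn_bounce:
  assumes "0 < k" "k < length w"
  shows "turn upper lower (if k = 1 then North else bounce_steps ! (k - 1)) (vertex bounce_steps k)
    = bounce_steps ! k"
proof -
  have length_1: "length (blocks w (Suc 0) 0) = 1" using count_0 by simp
  note blocks.simps(2) [simp del]
  obtain i r where k: "r < count_list w (Suc i)" "k = length (blocks w (Suc i) 0) + r"
    using bounce_position_pos[OF assms] .
  then have pos: "0 < count_list w (Suc i)" by simp
  have nth: "bounce_steps ! (length (blocks w j 0) + s) = dir j"
    if "s < count_list w j" for j s
  proof -
    have "0 < count_list w j" using that by simp
    then obtain post where "bounce_steps = blocks w j 0 @ replicate (count_list w j) (dir j) @ post"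
      using bounce_steps_decomposition by blast
    then show ?thesis using that by (simp add: nth_append)
  qed
  have at_k: "bounce_steps ! k = dir (Suc i)" unfolding k(2) by (rule nth[OF k(1)])
  have straight: ?thesis if "(if k = 1 then North else bounce_steps ! (k - 1)) = dir (Suc i)"
  proof -
    have "vertex bounce_steps k \<notin> end_points (dir i) (path i)"
    proof
      assume "vertex bounce_steps k \<in> end_points (dir i) (path i)"
      then obtain j where j: "j < length (path i)" "vertex bounce_steps k = vertex (path i) (Suc j)"
        by (auto simp: end_points_def)
      then have "k = Suc j"
        using vertex_eq_iff[of k bounce_steps "Suc j" "path i"] assms length_paths(1) by simp
      then have "count_list (take k bounce_steps) d = count_list (take k (path i)) d" for d
        using j(2) by (cases d) (simp_all add: vertex_def)
      then show False
        using path_less_bounce[OF k] by simp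
    qed
    then show ?thesis
      unfolding that at_k turn_dir by simp
  qed
  show ?thesis
  proof (cases "r = 0 \<and> 0 < i")
    case False
    have "(if k = 1 then North else bounce_steps ! (k - 1)) = dir (Suc i)"
    proof (cases "r = 0")
      case True
      then show ?thesis using False k(2) length_1 by (simp add: dir_def)
    next
      case r: False
      have "length (blocks w (Suc 0) 0) \<le> length (blocks w (Suc i) 0)"
        using blocks_add[of w 1 i 0] by simp
      then have "k \<noteq> 1" using k(2) r length_1 by simp
      moreover have "k - 1 = length (blocks w (Suc i) 0) + (r - 1)" "r - 1 < count_list w (Suc i)"
        using k r by simp_all
      then have "bounce_steps ! (k - 1) = dir (Suc i)"
        using nth by simp
      ultimately show ?thesis by simp
    qed
    then show ?thesis by (rule straight)
  next
    case True
    then obtain j where i: "i = Suc j" by (cases i) auto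
    have posj: "0 < count_list w i" "0 < count_list w j"
      using count_pos[OF pos, of i] count_pos[OF pos, of j] i by auto
    have kj: "k = length (blocks w i 0) + count_list w i"
      using k(2) True length_blocks_Suc by simp
    have "length (blocks w (Suc 0) 0) \<le> length (blocks w i 0)"
      using blocks_add[of w 1 j 0] i by simp
    then have "k \<noteq> 1" using kj posj(1) length_1 by simp
    moreover have "k - 1 = length (blocks w i 0) + (count_list w i - 1)"
      "count_list w i - 1 < count_list w i"
      using kj posj(1) by simp_all
    then have "bounce_steps ! (k - 1) = dir (Suc j)"
      by (simp only: nth i)
    moreover have "vertex bounce_steps k \<in> end_points (dir j) (path j)"
    proof -
      obtain pre post where p: "path (Suc i) = pre @ segment w (Suc i) @ post"
        "\<And>d. count_list pre d = count_list (blocks w (Suc i) 0) d"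
        "pre \<noteq> [] \<and> last pre = dir (Suc i)"
        using path_decomposition[OF pos] i by (metis Suc_le_mono zero_le numeral_2_eq_2)
      have len: "length pre = k"
        using length_counts_cong[OF p(2)] k(2) True by simp
      have "take k bounce_steps = blocks w (Suc i) 0"
        using take_bounce_steps[of 0 "Suc i"] k True by simp
      then have "vertex bounce_steps k = vertex (path j) (Suc (k - 1))"
        using p(1,2) len assms(1) i by (simp add: vertex_def path_def del: blocks.simps)
      moreover have "path j ! (k - 1) = dir j" "k - 1 < length (path j)"
        using p(1,3) len i assms by (auto simp: path_def nth_append last_conv_nth)
      ultimately show ?thesis unfolding end_points_def by blast
    qed
    ultimately show ?thesis
      using at_k i by (simp add: turn_dir)
  qed
qed

lemma vertex_Suc:
  "k < length p \<Longrightarrow> vertex p (Suc k) = move (p ! k) (vertex p k)"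
  by (cases "p ! k") (auto simp: vertex_def take_Suc_conv_app_nth)

lemma bounce_walk_eq:
  "0 < k \<Longrightarrow> k + r = length w \<Longrightarrow>
    bounce_walk upper lower r (if k = 1 then North else bounce_steps ! (k - 1)) (vertex bounce_steps k)
    = drop k bounce_steps"
proof (induction r arbitrary: k)
  case 0
  then show ?case using length_paths(1) by simp
next
  case (Suc r)
  have k: "0 < k" "k < length w" using Suc.prems by auto
  have "bounce_walk upper lower r (bounce_steps ! k) (vertex bounce_steps (Suc k)) =
      drop (Suc k) bounce_steps"
    using Suc.IH[of "Suc k"] Suc.prems by simp
  then show ?case
    unfolding bounce_walk.simps turn_bounce[OF k]
    using k length_paths(1) by (simp add: vertex_Suc[symmetric] Cons_nth_drop_Suc)
qed

lemma bounce_path_eq: "bounce_path (word_polyomino w) = bounce_steps"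
proof -
  obtain v where "length w = Suc v" using w_nonempty by (cases "length w") auto
  then have "bounce_steps = East # blocks w v 1"
    using count_0 by (simp add: bounce_steps_def dir_def)
  then have "vertex bounce_steps 1 = (1, 0)" "bounce_steps = East # drop 1 bounce_steps"
    by (simp_all add: vertex_def)
  then show ?thesis
    using bounce_walk_eq[of 1 "length w - 1"] w_nonempty length_paths(2)
    by (simp add: word_polyomino_eq Suc_le_eq)
qed

end

definition run_count :: "step list \<Rightarrow> step \<Rightarrow> nat" where
  "run_count p d = card {j. j < length p \<and> p ! j = d \<and> (j = 0 \<or> p ! (j - 1) \<noteq> p ! j)}"

definition label :: "step \<Rightarrow> nat \<Rightarrow> nat" where
  "label d r = (case d of North \<Rightarrow> r | East \<Rightarrow> r - 1)"

definition label_sum :: "step list \<Rightarrow> nat" where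
  "label_sum p = (\<Sum>k<length p. bounce_label p k)"

lemma run_count_Nil [simp]: "run_count [] d = 0"
  by (simp add: run_count_def)

lemma label_sum_Nil [simp]: "label_sum [] = 0"
  by (simp add: label_sum_def)

lemma run_count_snoc:
  "run_count (p @ [d]) e = run_count p e + (if d = e \<and> (p = [] \<or> last p \<noteq> d) then 1 else 0)"
proof -
  let ?S = "{j. j < length p \<and> p ! j = e \<and> (j = 0 \<or> p ! (j - 1) \<noteq> p ! j)}"
  let ?T = "if d = e \<and> (p = [] \<or> last p \<noteq> d) then {length p} else {}"
  have "{j. j < length (p @ [d]) \<and> (p @ [d]) ! j = e \<and>
      (j = 0 \<or> (p @ [d]) ! (j - 1) \<noteq> (p @ [d]) ! j)} = ?S \<union> ?T"
  proof (intro set_eqI)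
    fix j
    consider "j < length p" | "j = length p" | "length p < j" by linarith
    then show "j \<in> {j. j < length (p @ [d]) \<and> (p @ [d]) ! j = e \<and>
        (j = 0 \<or> (p @ [d]) ! (j - 1) \<noteq> (p @ [d]) ! j)} \<longleftrightarrow> j \<in> ?S \<union> ?T"
    proof cases
      case 1
      then have "j - Suc 0 < length p" by simp
      with 1 show ?thesis by (simp add: nth_append)
    next
      case 2
      then show ?thesis by (cases "p = []") (auto simp: nth_append last_conv_nth)
    next
      case 3
      then show ?thesis by simp
    qed
  qed
  moreover have "finite ?S" by simp
  ultimately show ?thesis
    unfolding run_count_def by (auto simp: card_insert_if)
qed

lemma run_number_append: "k < length p \<Longrightarrow> run_number (p @ q) k = run_number p k"
  unfolding run_number_def
  by (intro arg_cong[where f = card] Collect_cong) (auto simp: nth_append)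

lemma run_number_last: "run_number (p @ [d]) (length p) = run_count (p @ [d]) d"
  unfolding run_number_def run_count_def
  by (intro arg_cong[where f = card] Collect_cong) auto

lemma label_sum_snoc: "label_sum (p @ [d]) = label_sum p + label d (run_count (p @ [d]) d)"
proof -
  have "bounce_label (p @ [d]) k = bounce_label p k" if "k < length p" for k
    using that by (simp add: bounce_label_def run_number_append nth_append split: step.split)
  moreover have "bounce_label (p @ [d]) (length p) = label d (run_count (p @ [d]) d)"
    by (simp add: bounce_label_def run_number_last label_def split: step.split)
  ultimately show ?thesis
    by (simp add: label_sum_def)
qed

lemma run_count_replicate:
  assumes "p = [] \<or> last p \<noteq> d"
  shows "run_count (p @ replicate (Suc c) d) e = run_count p e + (if e = d then 1 else 0)"
proof (induction c)
  case 0
  then show ?case using assms run_count_snoc[of p d e] by auto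
next
  case (Suc c)
  have *: "p @ replicate (Suc (Suc c)) d = (p @ replicate (Suc c) d) @ [d]"
    by (simp add: replicate_append_same)
  show ?case unfolding * run_count_snoc Suc by simp
qed

lemma label_sum_replicate:
  assumes "p = [] \<or> last p \<noteq> d"
  shows "label_sum (p @ replicate c d) = label_sum p + c * label d (Suc (run_count p d))"
proof (induction c)
  case (Suc c)
  have *: "p @ replicate (Suc c) d = (p @ replicate c d) @ [d]"
    by (simp add: replicate_append_same)
  then have "run_count ((p @ replicate c d) @ [d]) d = Suc (run_count p d)"
    using run_count_replicate[OF assms, of c d] by simp
  then show ?case unfolding * label_sum_snoc Suc by simp
qed simp

context area_word_like
begin

lemma blocks_snoc: "blocks w (Suc b) 0 = blocks w b 0 @ replicate (count_list w b) (dir b)"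
  using blocks_add[of w b 1 0] by simp

lemma blocks_runs:
  assumes "0 < count_list w b"
  shows "run_count (blocks w (Suc b) 0) (dir b) = Suc (b div 2) \<and>
    run_count (blocks w (Suc b) 0) (dir (Suc b)) = Suc b div 2 \<and>
    blocks w (Suc b) 0 \<noteq> [] \<and> last (blocks w (Suc b) 0) = dir b"
  using assms
proof (induction b)
  case 0
  have "blocks w (Suc 0) 0 = [] @ [dir 0]" using count_0 by simp
  then show ?case by (simp only: run_count_snoc) simp
next
  case (Suc b)
  note IH = Suc.IH[OF count_pos_Suc[OF Suc.prems]]
  obtain c where c: "count_list w (Suc b) = Suc c" using Suc.prems by (cases "count_list w (Suc b)") auto
  show ?case
    unfolding blocks_snoc[of "Suc b"] c
    using IH by (simp add: run_count_replicate del: blocks.simps replicate.simps)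
qed

lemma label_sum_blocks: "label_sum (blocks w b 0) = (\<Sum>j<b. count_list w j * (Suc j div 2))"
proof (induction b)
  case (Suc b)
  show ?case
  proof (cases "count_list w b = 0")
    case True
    then show ?thesis unfolding blocks_snoc using Suc by simp
  next
    case False
    have "blocks w b 0 = [] \<or> last (blocks w b 0) \<noteq> dir b"
      "label (dir b) (Suc (run_count (blocks w b 0) (dir b))) = Suc b div 2"
    proof (atomize (full), cases b)
      case 0
      then show "(blocks w b 0 = [] \<or> last (blocks w b 0) \<noteq> dir b) \<and>
          label (dir b) (Suc (run_count (blocks w b 0) (dir b))) = Suc b div 2"
        by (simp add: label_def dir_def)
    next
      case (Suc a)
      then have "0 < count_list w a" using False count_pos_Suc[of a] by simp
      from blocks_runs[OF this] show "(blocks w b 0 = [] \<or> last (blocks w b 0) \<noteq> dir b) \<and>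
          label (dir b) (Suc (run_count (blocks w b 0) (dir b))) = Suc b div 2"
        by (cases "even a") (auto simp: Suc label_def dir_def simp del: blocks.simps elim: oddE)
    qed
    then show ?thesis
      unfolding blocks_snoc using label_sum_replicate Suc by simp
  qed
qed simp

lemma bounce_eq_word_sum: "bounce (word_polyomino w) = (\<Sum>x\<leftarrow>w. Suc x div 2)"
proof -
  have "bounce (word_polyomino w) = (\<Sum>j<length w. count_list w j * (Suc j div 2))"
    unfolding bounce_def bounce_path_eq label_sum_def[symmetric]
    unfolding bounce_steps_def by (rule label_sum_blocks)
  also have "\<dots> = (\<Sum>j\<in>set w. count_list w j * (Suc j div 2))"
    using letter_less_length by (intro sum.mono_neutral_right) (auto simp: count_list_0_iff)
  finally show ?thesis by (simp add: sum_list_map_eq_sum_count)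
qed

end

section \<open>The area of the polyomino of a word\<close>

primrec ascents :: "nat \<Rightarrow> nat list \<Rightarrow> nat" where
  "ascents i [] = 0"
| "ascents i (x # w) = (if x = i then count_list w (Suc i) else 0) + ascents i w"

lemma sum_ascents: "(\<And>x. x \<in> set w \<Longrightarrow> x < b) \<Longrightarrow> (\<Sum>i<b. ascents i w) = succ_pairs w"
  by (induction w) (auto simp: sum.distrib sum.delta)

lemma height_sum_snoc:
  "height_sum (p @ [d]) = height_sum p + count_list p North + (if d = North then 1 else 0)"
  by (simp add: height_sum_append height_sum_Cons)

lemma height_sum_East: "height_sum (replicate a East) = 0"
  by (induction a) (auto simp: height_sum_Cons)

lemma segment_Cons:
  "segment (x # w) i = segment w i @ (if x = i \<or> x = Suc i then [dir x] else [])"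
  by (simp add: segment_def)

lemma count_North_segment:
  "count_list (segment w i) North = count_list w (if even i then Suc i else i)"
proof -
  have "(x = i \<or> x = Suc i) \<and> dir x = North \<longleftrightarrow> x = (if even i then Suc i else i)" for x
    by (auto simp: dir_def)
  then show ?thesis by (simp only: count_list_segment count_list_filter[of w])
qed

lemma height_sum_segment:
  "even i \<Longrightarrow> height_sum (segment w i) =
     height_sum (blocks w (Suc (Suc 0)) i) + ascents i w"
  "odd i \<Longrightarrow> height_sum (segment w i) + ascents i w =
     height_sum (blocks w (Suc (Suc 0)) i)"
proof (induction w)
  case Nil
  { case 1 show ?case by (simp add: segment_def) next
    case 2 show ?case by (simp add: segment_def) }
next
  case (Cons x w)
  { case 1
    with Cons show ?case
      by (auto simp: segment_Cons height_sum_snoc height_sum_append height_sum_East height_sum_Cons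
          count_North_segment count_list_replicate dir_def)
  next
    case 2
    with Cons show ?case
      by (auto simp: segment_Cons height_sum_snoc height_sum_append height_sum_East height_sum_Cons
          count_North_segment count_list_replicate dir_def)
  }
qed

lemma height_sum_segments:
  "even i \<Longrightarrow> height_sum (segments w b i) =
     height_sum (blocks w (2 * b) i) + (\<Sum>j<b. ascents (i + 2 * j) w)"
  "odd i \<Longrightarrow> height_sum (segments w b i) + (\<Sum>j<b. ascents (i + 2 * j) w) =
     height_sum (blocks w (2 * b) i)"
proof (induction b arbitrary: i)
  case (Suc b)
  have count: "count_list (segments w c j) d = count_list (blocks w (2 * c) j) d" for c j d
    by (simp add: count_list_segments count_list_blocks)
  then have len: "length (segments w b j) = length (blocks w (2 * b) j)" for j
    by (intro length_counts_cong)
  have *: "blocks w (2 * Suc b) j = blocks w (Suc (Suc 0)) j @ blocks w (2 * b) (Suc (Suc j))" for j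
    using blocks_add[of w "Suc (Suc 0)" "2 * b" j] by simp
  have N: "count_list (segment w i) North = count_list (blocks w (Suc (Suc 0)) i) North" for i
    using count[of 1 i North] by (simp add: numeral_2_eq_2)
  let ?c = "\<lambda>i. count_list (segment w i) North * length (segments w b (Suc (Suc i)))"
  have H: "height_sum (segments w (Suc b) i) =
      height_sum (segment w i) + height_sum (segments w b (Suc (Suc i))) + ?c i" for i
    by (simp add: height_sum_append)
  have HB: "height_sum (blocks w (2 * Suc b) i) =
      height_sum (blocks w (Suc (Suc 0)) i) + height_sum (blocks w (2 * b) (Suc (Suc i))) + ?c i" for i
    unfolding * height_sum_append len N ..
  have A: "(\<Sum>j<Suc b. ascents (i + 2 * j) w) =
      ascents i w + (\<Sum>j<b. ascents (Suc (Suc i) + 2 * j) w)" for i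
    by (simp only: sum.lessThan_Suc_shift) simp
  { case (1 i)
    then have "even (Suc (Suc i))" by simp
    from Suc.IH(1)[OF this] height_sum_segment(1)[OF 1(1), of w] show ?case
      by (simp only: H HB A add_ac)
  next
    case (2 i)
    then have "odd (Suc (Suc i))" by simp
    from Suc.IH(2)[OF this, symmetric] height_sum_segment(2)[OF 2(1), of w, symmetric] show ?case
      by (simp only: H HB A add_ac)
  }
qed simp_all

lemma sum_even_odd: "(\<Sum>j<b. f (2 * j)) + (\<Sum>j<b. f (Suc (2 * j))) = (\<Sum>j<2 * b. f j)"
  for f :: "nat \<Rightarrow> nat"
  by (induction b) auto

context area_word_like
begin

lemma area_word_polyomino: "area (word_polyomino w) = succ_pairs w"
proof -
  let ?b = "length w"
  have "blocks w (Suc (2 * ?b)) 0 = East # blocks w (2 * ?b) 1"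
    using count_0 by (simp add: dir_def)
  moreover have "blocks w (Suc (2 * ?b)) 0 = blocks w (2 * ?b) 0"
    unfolding blocks_snoc using count_large[of "2 * ?b"] by simp
  ultimately have "blocks w (2 * ?b) 0 = East # blocks w (2 * ?b) 1"
    by metis
  then have "height_sum (blocks w (2 * ?b) 0) = height_sum (blocks w (2 * ?b) 1)"
    by (simp add: height_sum_Cons)
  then have "height_sum upper = height_sum lower + ((\<Sum>j<?b. ascents (2 * j) w) + (\<Sum>j<?b. ascents (Suc (2 * j)) w))"
    using height_sum_segments(1)[of 0 w ?b] height_sum_segments(2)[of 1 w ?b]
    by (simp add: upper_def lower_def height_sum_Cons)
  also have "\<dots> = height_sum lower + succ_pairs w"
    unfolding sum_even_odd[of "\<lambda>j. ascents j w"]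
    using letter_less_length by (subst sum_ascents) fastforce+
  finally have "height_sum upper = height_sum lower + succ_pairs w" .
  moreover have "height lower k \<le> height upper k" for k
    using lower_below_upper[of k] length_paths count_list_upper[of North] count_list_lower[of North]
    by (cases "k = 0 \<or> length w \<le> k") (auto intro: less_imp_le)
  then have "area (upper, lower) + height_sum lower = height_sum upper"
    using length_paths count_list_upper[of North] count_list_lower[of North]
    by (intro area_height_sum) auto
  ultimately show ?thesis by (simp add: word_polyomino_eq)
qed

lemma segments_length:
  "segments w (length w) i = segment w i @ segments w (length w) (Suc (Suc i))"
proof -
  have "segments w (Suc (length w)) i = segments w (length w) i @ segment w (i + 2 * length w)"
    using segments_add[of w "length w" 1 i] by simp
  moreover have "segment w (i + 2 * length w) = []"
    using length_segment[of "i + 2 * length w"] count_large by simp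
  ultimately show ?thesis by simp
qed

end

section \<open>Injectivity and the bijection\<close>

lemma append_eq_ending:
  assumes "p @ u = q @ v" "count_list p d = count_list q d"
    and "p \<noteq> [] \<Longrightarrow> last p = d" "q \<noteq> [] \<Longrightarrow> last q = d"
  shows "p = q"
proof -
  have *: "us = []" if "p' = q' @ us" "count_list p' d = count_list q' d" "p' \<noteq> [] \<Longrightarrow> last p' = d"
    for p' q' us :: "'a list"
  proof (rule ccontr)
    assume "us \<noteq> []"
    then have "d \<in> set us" using that last_in_set[of us] by auto
    then show False using that by (metis add_cancel_left_right count_list_append count_list_0_iff)
  qed
  obtain us where "p = q @ us \<or> q = p @ us"
    using assms(1) by (auto simp: append_eq_append_conv2)
  then show ?thesis using * assms by (metis append_Nil2)
qed

lemma successively_filter_hd: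
  assumes "a < b" "successively (\<lambda>x y. y \<le> Suc x) (a # u)"
    and filters: "\<And>i. filter (\<lambda>x. x = i \<or> x = Suc i) (a # u) =
      filter (\<lambda>x. x = i \<or> x = Suc i) (b # u')"
  shows False
proof -
  obtain c where c: "b = Suc c" "a \<le> c" using assms(1) by (cases b) auto
  have "filter (\<lambda>x. x = c \<or> x = Suc c) (a # u) =
      b # filter (\<lambda>x. x = c \<or> x = Suc c) u'"
    unfolding filters[of c] by (simp add: c)
  then have "b = c" by (rule successively_first[OF assms(2) c(2)])
  then show False using c by simp
qed

lemma successively_filter_inj:
  assumes "successively (\<lambda>x y. y \<le> Suc x) (x # v)" "successively (\<lambda>x y. y \<le> Suc x) (x # v')"
    and "\<And>i. filter (\<lambda>x. x = i \<or> x = Suc i) v = filter (\<lambda>x. x = i \<or> x = Suc i) v'"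
  shows "v = v'"
  using assms
proof (induction v arbitrary: x v')
  case Nil
  show ?case
    using Nil.prems(3)[of "hd v'"] by (cases v') auto
next
  case (Cons a u)
  show ?case
  proof (cases v')
    case Nil
    then show ?thesis using Cons.prems(3)[of a] by simp
  next
    case (Cons b u')
    have succ: "successively (\<lambda>x y. y \<le> Suc x) (a # u)"
        "successively (\<lambda>x y. y \<le> Suc x) (b # u')"
      using Cons.prems(1,2) local.Cons by simp_all
    have filters: "filter (\<lambda>x. x = i \<or> x = Suc i) (a # u) = filter (\<lambda>x. x = i \<or> x = Suc i) (b # u')" for i
      using Cons.prems(3)[of i] local.Cons by simp
    have "\<not> a < b" using successively_filter_hd[OF _ succ(1) filters] by blast
    moreover have "\<not> b < a" using successively_filter_hd[OF _ succ(2) filters[symmetric]] by blast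
    ultimately have "a = b" by simp
    moreover have "u = u'"
    proof (rule Cons.IH)
      show "successively (\<lambda>x y. y \<le> Suc x) (a # u)" "successively (\<lambda>x y. y \<le> Suc x) (a # u')"
        using succ \<open>a = b\<close> by simp_all
      show "filter (\<lambda>x. x = i \<or> x = Suc i) u = filter (\<lambda>x. x = i \<or> x = Suc i) u'" for i
        using filters[of i] \<open>a = b\<close> by (simp split: if_splits)
    qed
    ultimately show ?thesis using local.Cons by simp
  qed
qed

lemma segment_inj:
  assumes "segment w i = segment w' i"
  shows "filter (\<lambda>x. x = i \<or> x = Suc i) w = filter (\<lambda>x. x = i \<or> x = Suc i) w'"
proof -
  have "inj_on dir {i, Suc i}" by (auto simp: inj_on_def)
  then have "inj_on dir (set (rev (filter (\<lambda>x. x = i \<or> x = Suc i) w)) \<union>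
      set (rev (filter (\<lambda>x. x = i \<or> x = Suc i) w')))"
    by (rule inj_on_subset) auto
  with assms have "rev (filter (\<lambda>x. x = i \<or> x = Suc i) w) = rev (filter (\<lambda>x. x = i \<or> x = Suc i) w')"
    unfolding segment_def by (rule map_inj_on)
  then show ?thesis by simp
qed

lemma word_polyomino_inj:
  assumes "area_word_like w" "area_word_like w'" "word_polyomino w = word_polyomino w'"
  shows "w = w'"
proof -
  interpret w: area_word_like w by fact
  interpret w': area_word_like w' by fact
  have len: "length w = length w'"
    using assms(3) w.length_paths(2) w'.length_paths(2)
    by (simp add: w.word_polyomino_eq w'.word_polyomino_eq)
  define T where "T v i = segments v (length v) i" for v i
  have seg: "segment w i = segment w' i"
    if "T w i = T w' i" "count_list w i = count_list w' i" for i
  proof (rule append_eq_ending[where d = "dir i"])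
    show "segment w i @ T w (Suc (Suc i)) = segment w' i @ T w' (Suc (Suc i))"
      using that(1) w.segments_length[of i] w'.segments_length[of i] by (simp add: T_def)
  qed (use that w.last_segment w'.last_segment in \<open>auto simp: w.count_segment w'.count_segment\<close>)
  text \<open>The number of letters \<open>i\<close> tells where \<open>segment w i\<close> ends in the path; its length then gives the
    number of letters \<open>i + 1\<close>.\<close>
  have *: "count_list w i = count_list w' i \<and> T w i = T w' i \<and> T w (Suc i) = T w' (Suc i)" for i
  proof (induction i)
    case 0
    then show ?case
      using assms(3) w.count_0 w'.count_0 by (simp add: word_polyomino_def T_def)
  next
    case (Suc i)
    then have s: "segment w i = segment w' i" using seg by blast
    then have "count_list w (Suc i) = count_list w' (Suc i)"
      using w.count_segment(2)[of i] w'.count_segment(2)[of i] by simp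
    moreover have "T w (Suc (Suc i)) = T w' (Suc (Suc i))"
      using s Suc w.segments_length[of i] w'.segments_length[of i] by (simp add: T_def)
    ultimately show ?case using Suc by simp
  qed
  obtain v v' where v: "w = 0 # v" "w' = 0 # v'"
    using w.w_nonempty w.w_hd w'.w_nonempty w'.w_hd by (metis list.collapse)
  have filters: "filter (\<lambda>x. x = i \<or> x = Suc i) (0 # v) = filter (\<lambda>x. x = i \<or> x = Suc i) (0 # v')" for i
    using segment_inj seg * v by metis
  have tails: "filter (\<lambda>x. x = i \<or> x = Suc i) v = filter (\<lambda>x. x = i \<or> x = Suc i) v'" for i
    using filters[of i] by (simp split: if_splits)
  have "successively (\<lambda>x y. y \<le> Suc x) (0 # v)" "successively (\<lambda>x y. y \<le> Suc x) (0 # v')"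
    using w.w_successively w'.w_successively unfolding v by blast+
  then have "v = v'" using tails by (rule successively_filter_inj)
  then show ?thesis by (simp add: v)
qed

lemma area_words_area_word_like: "w \<in> area_words e d \<Longrightarrow> area_word_like w"
  by (simp add: area_words_def area_word_like_def)

definition polyomino_map :: "polyomino \<Rightarrow> polyomino" where
  "polyomino_map P = word_polyomino (polyomino_word P)"

lemma polyomino_map:
  assumes "m \<ge> 1" "n \<ge> 1"
  shows polyomino_map_mem: "P \<in> Polyo n m \<Longrightarrow> polyomino_map P \<in> Polyo m n"
    and area_polyomino_map: "P \<in> Polyo n m \<Longrightarrow> area (polyomino_map P) = dinv P"
    and bounce_polyomino_map: "P \<in> Polyo n m \<Longrightarrow> bounce (polyomino_map P) = area P"
    and polyomino_map_inj: "inj_on polyomino_map (Polyo n m)"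
proof -
  have mem: "polyomino_word P \<in> area_words m n" if "P \<in> Polyo n m" for P
    using polyomino_word_mem[OF assms(2,1) that] .
  note like = mem[THEN area_words_area_word_like]
  show "polyomino_map P \<in> Polyo m n" if "P \<in> Polyo n m"
    using area_word_like.word_polyomino_Polyo[OF like[OF that] _ _ assms] mem[OF that]
    by (simp add: polyomino_map_def area_words_def)
  show "area (polyomino_map P) = dinv P" if "P \<in> Polyo n m"
    using area_word_like.area_word_polyomino[OF like[OF that]]
      dinv_eq_succ_pairs[OF assms(2,1) that] by (simp add: polyomino_map_def)
  show "bounce (polyomino_map P) = area P" if "P \<in> Polyo n m"
    using area_word_like.bounce_eq_word_sum[OF like[OF that]]
      area_eq_word_sum[OF assms(2,1) that] by (simp add: polyomino_map_def)
  show "inj_on polyomino_map (Polyo n m)"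
  proof (rule inj_onI)
    fix P Q assume PQ: "P \<in> Polyo n m" "Q \<in> Polyo n m" "polyomino_map P = polyomino_map Q"
    have "polyomino_word P = polyomino_word Q"
      using PQ(3) unfolding polyomino_map_def
      by (rule word_polyomino_inj[OF like[OF PQ(1)] like[OF PQ(2)]])
    then show "P = Q"
      using inj_onD[OF polyomino_word_inj[OF assms(2,1)]] PQ(1,2) by blast
  qed
qed

text \<open>Surjectivity is obtained by counting: \<^const>\<open>polyomino_map\<close> also injects
  \<^term>\<open>Polyo m n\<close> into \<^term>\<open>Polyo n m\<close>.\<close>

lemma bij_betw_polyomino_map:
  assumes "m \<ge> 1" "n \<ge> 1"
  shows "bij_betw polyomino_map (Polyo n m) (Polyo m n)"
proof -
  have sub: "polyomino_map ` Polyo n m \<subseteq> Polyo m n" "polyomino_map ` Polyo m n \<subseteq> Polyo n m"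
    using polyomino_map_mem[OF assms] polyomino_map_mem[OF assms(2,1)] by blast+
  have "card (Polyo n m) \<le> card (Polyo m n)"
    using polyomino_map_inj[OF assms] sub(1) finite_Polyo by (rule card_inj_on_le)
  moreover have "card (Polyo m n) \<le> card (Polyo n m)"
    using polyomino_map_inj[OF assms(2,1)] sub(2) finite_Polyo by (rule card_inj_on_le)
  moreover have "card (polyomino_map ` Polyo n m) = card (Polyo n m)"
    using polyomino_map_inj[OF assms] by (rule card_image)
  ultimately have "polyomino_map ` Polyo n m = Polyo m n"
    using sub(1) finite_Polyo by (intro card_subset_eq) simp_all
  then show ?thesis
    using polyomino_map_inj[OF assms] by (simp add: bij_betw_def)
qed

theorem theorem4p1:
  fixes m n :: nat and q t :: "'a :: comm_semiring_1"
  assumes "m \<ge> 1" and "n \<ge> 1"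
  shows "(\<Sum>P\<in>Polyo m n. q ^ area P * t ^ bounce P) =
           (\<Sum>P\<in>Polyo n m. q ^ dinv P * t ^ area P) \<and>
         (\<exists>f. bij_betw f (Polyo m n) (Polyo n m) \<and>
              (\<forall>P\<in>Polyo m n. dinv (f P) = area P \<and> area (f P) = bounce P))"
proof
  note bij = bij_betw_polyomino_map[OF assms]
  have "(\<Sum>P\<in>Polyo n m. q ^ dinv P * t ^ area P) =
      (\<Sum>P\<in>Polyo n m. q ^ area (polyomino_map P) * t ^ bounce (polyomino_map P))"
    using area_polyomino_map[OF assms] bounce_polyomino_map[OF assms] by (intro sum.cong) auto
  also have "\<dots> = (\<Sum>P\<in>Polyo m n. q ^ area P * t ^ bounce P)"
    using bij by (rule sum.reindex_bij_betw)
  finally show "(\<Sum>P\<in>Polyo m n. q ^ area P * t ^ bounce P) =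
      (\<Sum>P\<in>Polyo n m. q ^ dinv P * t ^ area P)" ..
  define f where "f = inv_into (Polyo n m) polyomino_map"
  have "bij_betw f (Polyo m n) (Polyo n m)"
    unfolding f_def by (rule bij_betw_inv_into[OF bij])
  moreover have "dinv (f P) = area P \<and> area (f P) = bounce P" if "P \<in> Polyo m n" for P
  proof -
    have "f P \<in> Polyo n m" "polyomino_map (f P) = P"
      using bij that unfolding f_def bij_betw_def by (auto intro: inv_into_into f_inv_into_f)
    then show ?thesis
      using area_polyomino_map[OF assms, of "f P"] bounce_polyomino_map[OF assms, of "f P"] by simp
  qed
  ultimately show "\<exists>f. bij_betw f (Polyo m n) (Polyo n m) \<and>
      (\<forall>P\<in>Polyo m n. dinv (f P) = area P \<and> area (f P) = bounce P)"
    by blast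
qed

end
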